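(* There is a deterministic $O(\log\eta)$-competitive and a randomized $O(\log\log\eta)$-competitive (against oblivious adversaries) learning-augmented online algorithm for weighted path augmentation, and likewise for the parking permit problem.
   Context: Weighted path augmentation (WPAP): an instance $(E,\mathcal{L},\mathsf{cost})$ consists of elements $E=\{1,\dots,n\}$ (the edges of a path, in order) and a set $\mathcal{L}$ of links with costs $\mathsf{cost}:\mathcal{L}\to\mathbb{R}_{\ge0}$, each link covering a set of consecutive elements $\{a,a+1,\dots,b\}$; the instance is known in advance. Elements of $X\subseteq E$ arrive one by one, and upon arrival each must be covered by an irrevocably purchased link; the cost is the total cost of purchased links. The parking permit problem is the special case in which there are $K$ permit types, type $j$ having a duration $d_j$ and cost $c_j$, and the links are the intervals of $d_j$ consecutive elements of cost $c_j$. A learning-augmented algorithm receives beforehand a predicted set $\hat{X}$; the prediction error is $\eta:=\min(|X|,|(X\setminus\hat{X})\cup(\hat{X}\setminus X)|)$. Competitive ratio $\rho$: (expected) cost always at most $\rho$ times the minimum cost of links covering $X$. *)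

theory Defs
  imports "HOL-Probability.Probability_Mass_Function" "HOL-Library.Landau_Symbols"
begin

section \<open>Weighted path augmentation\<close>

text \<open>Links are abstract labels, so several links may cover the same interval at different costs.\<close>

record 'l wpap =
  num_elems :: nat
  links :: "'l set"
  cover :: "'l \<Rightarrow> nat set"
  cost :: "'l \<Rightarrow> real"

definition elems :: "'l wpap \<Rightarrow> nat set" where
  "elems I = {1..num_elems I}"

definition wpap_instances :: "'l wpap set" where
  "wpap_instances = {I. finite (links I) \<and>
     (\<forall>l\<in>links I. 0 \<le> cost I l \<and>
        (\<exists>a b. 1 \<le> a \<and> a \<le> b \<and> b \<le> num_elems I \<and> cover I l = {a..b}))}"

definition covered :: "'l wpap \<Rightarrow> 'l set \<Rightarrow> nat set" where
  "covered I F = (\<Union>l\<in>F. cover I l)"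

definition total_cost :: "'l wpap \<Rightarrow> 'l set \<Rightarrow> real" where
  "total_cost I F = (\<Sum>l\<in>F. cost I l)"

text \<open>The minimum is only meaningful if all of \<open>X\<close> can be covered; see \<open>request_seqs\<close>.\<close>

definition opt :: "'l wpap \<Rightarrow> nat set \<Rightarrow> real" where
  "opt I X = Min (total_cost I ` {F. F \<subseteq> links I \<and> X \<subseteq> covered I F})"

text \<open>
  The arrival orders of the sets \<open>X\<close> of elements. An element lying on no link cannot be served by
  anyone, so it is never requested; all other elements may arrive, in any order.
\<close>

definition request_seqs :: "'l wpap \<Rightarrow> nat list set" where
  "request_seqs I = {xs. distinct xs \<and> set xs \<subseteq> elems I \<and> set xs \<subseteq> covered I (links I)}"


section \<open>The parking permit problem\<close>

text \<open>
  Link \<open>(j, a)\<close> is the permit of type \<open>j\<close> for the \<open>d j\<close> consecutive elements starting at \<open>a\<close>.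
\<close>

definition parking_permit :: "nat \<Rightarrow> nat \<Rightarrow> (nat \<Rightarrow> nat) \<Rightarrow> (nat \<Rightarrow> real) \<Rightarrow> (nat \<times> nat) wpap" where
  "parking_permit n K d c =
     \<lparr> num_elems = n,
       links = {(j, a). j \<in> {1..K} \<and> 1 \<le> a \<and> a + d j \<le> n + 1},
       cover = (\<lambda>(j, a). {a..<a + d j}),
       cost = (\<lambda>(j, a). c j) \<rparr>"

definition parking_permit_instances :: "(nat \<times> nat) wpap set" where
  "parking_permit_instances =
     {parking_permit n K d c | n K d c. \<forall>j\<in>{1..K}. 1 \<le> d j \<and> 0 \<le> c j}"

lemma parking_permit_instances_subset: "parking_permit_instances \<subseteq> wpap_instances"
proof
  fix I assume "I \<in> parking_permit_instances"
  then obtain n K d c where I: "I = parking_permit n K d c"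
    and dc: "\<forall>j\<in>{1..K}. 1 \<le> d j \<and> 0 \<le> c j"
    by (auto simp: parking_permit_instances_def)
  have "links I \<subseteq> {1..K} \<times> {1..n + 1}"
    by (auto simp: I parking_permit_def)
  hence "finite (links I)"
    by (rule finite_subset) simp
  moreover have "0 \<le> cost I l \<and>
      (\<exists>a b. 1 \<le> a \<and> a \<le> b \<and> b \<le> num_elems I \<and> cover I l = {a..b})"
    if "l \<in> links I" for l
  proof -
    obtain j a where "l = (j, a)"
      by (cases l)
    with that have l: "l = (j, a)" "j \<in> {1..K}" "1 \<le> a" "a + d j \<le> n + 1"
      by (auto simp: I parking_permit_def)
    have "1 \<le> d j" "0 \<le> c j"
      using dc l(2) by auto
    moreover from this have "{a..<a + d j} = {a..a + d j - 1}"
      by auto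
    ultimately show ?thesis
      using l by (intro conjI exI[of _ a] exI[of _ "a + d j - 1"])
        (auto simp: I parking_permit_def)
  qed
  ultimately show "I \<in> wpap_instances"
    by (auto simp: wpap_instances_def)
qed


section \<open>Learning-augmented online algorithms\<close>

text \<open>
  A strategy maps the sequence of elements that have arrived so far to the links purchased upon
  the arrival of the last of them. Purchases are irrevocable: what is owned after \<open>xs\<close> is the union
  of the purchases at all nonempty prefixes of \<open>xs\<close>.
\<close>

type_synonym 'l strategy = "nat list \<Rightarrow> 'l set"

definition purchased :: "'l strategy \<Rightarrow> nat list \<Rightarrow> 'l set" where
  "purchased S xs = (\<Union>i<length xs. S (take (Suc i) xs))"

definition serves :: "'l wpap \<Rightarrow> 'l strategy \<Rightarrow> nat list \<Rightarrow> bool" where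
  "serves I S xs \<longleftrightarrow> (\<forall>i<length xs.
     S (take (Suc i) xs) \<subseteq> links I \<and> xs ! i \<in> covered I (purchased S (take (Suc i) xs)))"

definition pred_error :: "nat set \<Rightarrow> nat set \<Rightarrow> nat" where
  "pred_error X Xhat = min (card X) (card ((X - Xhat) \<union> (Xhat - X)))"

text \<open>
  An algorithm sees the instance and the predicted set in advance, but neither the error nor
  future arrivals. A randomized algorithm against an oblivious adversary is a distribution over
  strategies: the arrival sequence is fixed before the strategy is drawn. As there are finitely
  many links, the costs below are bounded, hence integrable.
\<close>

type_synonym 'l det_alg = "'l wpap \<Rightarrow> nat set \<Rightarrow> 'l strategy"
type_synonym 'l rand_alg = "'l wpap \<Rightarrow> nat set \<Rightarrow> 'l strategy pmf"

definition det_competitive :: "'l wpap set \<Rightarrow> (nat \<Rightarrow> real) \<Rightarrow> 'l det_alg \<Rightarrow> bool" where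
  "det_competitive \<I> \<rho> A \<longleftrightarrow>
     (\<forall>I\<in>\<I>. \<forall>Xhat. Xhat \<subseteq> elems I \<longrightarrow> (\<forall>xs\<in>request_seqs I.
        serves I (A I Xhat) xs \<and>
        total_cost I (purchased (A I Xhat) xs) \<le> \<rho> (pred_error (set xs) Xhat) * opt I (set xs)))"

definition rand_competitive :: "'l wpap set \<Rightarrow> (nat \<Rightarrow> real) \<Rightarrow> 'l rand_alg \<Rightarrow> bool" where
  "rand_competitive \<I> \<rho> A \<longleftrightarrow>
     (\<forall>I\<in>\<I>. \<forall>Xhat. Xhat \<subseteq> elems I \<longrightarrow> (\<forall>xs\<in>request_seqs I.
        (\<forall>S\<in>set_pmf (A I Xhat). serves I S xs) \<and>
        measure_pmf.expectation (A I Xhat) (\<lambda>S. total_cost I (purchased S xs))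
          \<le> \<rho> (pred_error (set xs) Xhat) * opt I (set xs)))"

end

theory Submission
  imports Defs "HOL-Probability.Product_PMF"
begin

text \<open>
  Links of cost at most \<open>u * 8 ^ j\<close> induce, for each level \<open>j\<close>, a partition of the path into segments:
  each level coarsens the one below, a link of that cost meets at most two segments, and each of
  these costs at most \<open>2 * u * 8 ^ j\<close> to cover. On this hierarchy one plays ski rental in every
  segment: it is bought once the cost incurred inside it (the rent) exceeds a threshold times its
  price. A threshold rule that loses a factor \<open>1 + 1 / K\<close> against renting and \<open>T + 1\<close> against buying
  yields ratio \<open>O(T)\<close> over \<open>K\<close> levels, because \<open>(1 + 1 / K) ^ K \<le> 3\<close>. Deterministically \<open>T = K\<close>; with random
  thresholds of probabilities proportional to \<open>2 ^ t\<close> one reaches \<open>K = 2 ^ T - 1\<close>. Links of cost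
  at most \<open>G / 8 ^ K\<close>, one per request, are negligible against \<open>G\<close> when there are at most \<open>2 ^ K\<close> requests,
  so \<open>K\<close> levels suffice for \<open>2 ^ K\<close> requests if the optimum is at most \<open>G\<close>.

  The prediction enters through a doubling budget \<open>G\<close>: first buy links of total cost at most \<open>G\<close> that
  leave as few predicted elements uncovered as possible, then run the hierarchical algorithm on the
  requests that are still uncovered until its (expected) cost exceeds \<open>G\<close>. Once \<open>G\<close> reaches the optimum,
  only \<open>\<eta>\<close> requests remain for the hierarchical algorithm.
\<close>

section \<open>Ski rental in a hierarchy\<close>

lemma sum_UN_le:
  fixes f :: "'a \<Rightarrow> real"
  assumes "finite A" "\<And>i. i \<in> A \<Longrightarrow> finite (B i)" "\<And>i x. i \<in> A \<Longrightarrow> x \<in> B i \<Longrightarrow> 0 \<le> f x"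
  shows "sum f (\<Union>i\<in>A. B i) \<le> (\<Sum>i\<in>A. sum f (B i))"
  using assms
proof (induction A rule: finite_induct)
  case (insert a A)
  have "sum f (B a \<union> (\<Union>i\<in>A. B i)) \<le> sum f (B a) + sum f (\<Union>i\<in>A. B i)"
    using insert.prems insert.hyps sum_nonneg[of "B a \<inter> (\<Union>i\<in>A. B i)" f]
    by (subst sum_Un) auto
  moreover have "sum f (\<Union>i\<in>A. B i) \<le> (\<Sum>i\<in>A. sum f (B i))"
    by (rule insert.IH) (auto intro: insert.prems)
  ultimately show ?case using insert.hyps by simp
qed simp

lemma expectation_sum_finite:
  assumes "finite (set_pmf p)"
  shows "measure_pmf.expectation p (\<lambda>x. \<Sum>i\<in>A. f i x :: real)
    = (\<Sum>i\<in>A. measure_pmf.expectation p (f i))"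
  by (rule Bochner_Integration.integral_sum) (auto intro: integrable_measure_pmf_finite assms)

lemma expectation_mono_finite:
  assumes "finite (set_pmf p)" "\<And>x. x \<in> set_pmf p \<Longrightarrow> f x \<le> (g x :: real)"
  shows "measure_pmf.expectation p f \<le> measure_pmf.expectation p g"
  using assms by (intro integral_mono_AE) (auto intro: integrable_measure_pmf_finite AE_pmfI)

lemma finite_set_Pi_pmf:
  assumes "finite A" "\<And>x. x \<in> A \<Longrightarrow> finite (set_pmf (p x))"
  shows "finite (set_pmf (Pi_pmf A d p))"
  using assms by (simp add: set_Pi_pmf finite_PiE_dflt)

text \<open>Fubini for one independent coordinate. It allows the threshold of the top level to be
  fixed while those below are averaged.\<close>

lemma expectation_Pi_pmf_insert:
  fixes h :: "('i \<Rightarrow> 'b) \<Rightarrow> real"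
  assumes "finite A" "x \<notin> A" "\<And>i. i \<in> insert x A \<Longrightarrow> finite (set_pmf (p i))"
  shows "measure_pmf.expectation (Pi_pmf (insert x A) d p) h
    = measure_pmf.expectation (p x) (\<lambda>t. measure_pmf.expectation (Pi_pmf A d p) (\<lambda>f. h (f(x := t))))"
proof -
  have fin: "finite (set_pmf (p x))" "finite (set_pmf (Pi_pmf A d p))"
    using assms by (auto intro: finite_set_Pi_pmf)
  have "measure_pmf.expectation (Pi_pmf (insert x A) d p) h
      = measure_pmf.expectation (p x \<bind> (\<lambda>y. map_pmf (\<lambda>f. f(x := y)) (Pi_pmf A d p))) h"
    using assms by (subst Pi_pmf_insert') (auto simp: map_pmf_def)
  also have "\<dots> = (\<Sum>a\<in>set_pmf (p x). pmf (p x) a *\<^sub>R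
      measure_pmf.expectation (map_pmf (\<lambda>f. f(x := a)) (Pi_pmf A d p)) h)"
    using fin by (intro pmf_expectation_bind) auto
  also have "\<dots> = measure_pmf.expectation (p x)
      (\<lambda>t. measure_pmf.expectation (Pi_pmf A d p) (\<lambda>f. h (f(x := t))))"
    using fin by (subst integral_measure_pmf[of "set_pmf (p x)"]) auto
  finally show ?thesis .
qed

text \<open>The values of \<open>seg j\<close> name the segments of level \<open>j\<close>, and
  \<open>pack j v\<close> is what buying segment \<open>v\<close> means. \<open>infl\<close> and
  \<open>cap\<close> are the factors that a threshold rule loses against renting and against
  buying.\<close>

locale rental_hierarchy =
  fixes seg :: "nat \<Rightarrow> nat \<Rightarrow> nat" and pack :: "nat \<Rightarrow> nat \<Rightarrow> 'l set"
    and c :: "'l \<Rightarrow> real" and infl cap :: real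
  assumes nested: "seg j x = seg j y \<Longrightarrow> seg (Suc j) x = seg (Suc j) y"
    and finite_pack: "finite (pack j v)"
    and c_nonneg: "l \<in> pack j v \<Longrightarrow> 0 \<le> c l"
    and infl_ge_1: "1 \<le> infl" and cap_ge_1: "1 \<le> cap"
begin

definition price :: "nat \<Rightarrow> nat \<Rightarrow> real" where
  "price j v = sum c (pack j v)"

definition part :: "nat \<Rightarrow> nat \<Rightarrow> nat set \<Rightarrow> nat set" where
  "part j v X = {x \<in> X. seg j x = v}"

text \<open>Bounds the expected cost incurred inside a segment, by applying the guarantee of the
  threshold rule recursively. It depends neither on the order of the requests nor on the random
  thresholds, so it is known online, and it is monotone in the set of requests.\<close>

primrec charge :: "nat \<Rightarrow> nat \<Rightarrow> nat set \<Rightarrow> real" where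
  "charge 0 v X = (if part 0 v X = {} then 0 else price 0 v)"
| "charge (Suc j) v X =
     min (infl * (\<Sum>u\<in>seg j ` part (Suc j) v X. charge j u X)) (cap * price (Suc j) v)"

definition rent :: "nat \<Rightarrow> nat \<Rightarrow> nat set \<Rightarrow> real" where
  "rent j v X = (\<Sum>u\<in>seg j ` part (Suc j) v X. charge j u X)"

text \<open>Picks the coarsest level whose rent has reached its threshold; level \<open>0\<close> is
  the default. Since rent is measured by charges instead of actual expenses, whether a level
  triggers depends on no threshold but its own.\<close>

primrec level :: "(nat \<Rightarrow> nat) \<Rightarrow> nat \<Rightarrow> nat set \<Rightarrow> nat \<Rightarrow> nat" where
  "level \<tau> 0 X e = 0"
| "level \<tau> (Suc k) X e =
     (if real (\<tau> (Suc k)) * price (Suc k) (seg (Suc k) e) \<le> rent k (seg (Suc k) e) X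
      then Suc k else level \<tau> k X e)"

definition respond :: "(nat \<Rightarrow> nat) \<Rightarrow> nat \<Rightarrow> nat list \<Rightarrow> 'l set" where
  "respond \<tau> k xs = (let j = level \<tau> k (set xs) (last xs) in pack j (seg j (last xs)))"

definition owned :: "(nat \<Rightarrow> nat) \<Rightarrow> nat \<Rightarrow> nat \<Rightarrow> nat list \<Rightarrow> 'l set" where
  "owned \<tau> k v xs = (\<Union>i\<in>{i. i < length xs \<and> seg k (xs ! i) = v}. respond \<tau> k (take (Suc i) xs))"

definition total_charge :: "nat \<Rightarrow> nat set \<Rightarrow> real" where
  "total_charge k X = (\<Sum>v\<in>seg k ` X. charge k v X)"

lemma price_nonneg: "0 \<le> price j v"
  by (auto simp: price_def intro!: sum_nonneg c_nonneg)

lemma charge_nonneg: "0 \<le> charge j v X"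
  using infl_ge_1 cap_ge_1 price_nonneg
  by (induction j arbitrary: v) (auto intro!: sum_nonneg mult_nonneg_nonneg)

lemma rent_nonneg: "0 \<le> rent j v X"
  by (auto simp: rent_def intro!: sum_nonneg charge_nonneg)

lemma charge_Suc: "charge (Suc j) v X = min (infl * rent j v X) (cap * price (Suc j) v)"
  by (simp add: rent_def)

lemma part_nested:
  assumes "u \<in> seg j ` part (Suc j) v X"
  shows "part j u Y = part j u (part (Suc j) v Y)"
proof -
  obtain x where x: "u = seg j x" "seg (Suc j) x = v"
    using assms by (auto simp: part_def)
  then have "seg (Suc j) y = v" if "seg j y = u" for y
    using nested[of j y x] that by simp
  then show ?thesis by (auto simp: part_def)
qed

lemma charge_cong: "part j v X = part j v Y \<Longrightarrow> charge j v X = charge j v Y"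
proof (induction j arbitrary: v)
  case (Suc j)
  have "charge j u X = charge j u Y" if "u \<in> seg j ` part (Suc j) v X" for u
    by (rule Suc.IH) (simp add: part_nested[OF that, of X] part_nested[OF that, of Y] Suc.prems)
  then show ?case using Suc.prems by (auto intro!: arg_cong2[of _ _ _ _ min] sum.cong)
qed simp

lemma charge_mono:
  assumes "finite Y" "X \<subseteq> Y"
  shows "charge j v X \<le> charge j v Y"
proof (induction j arbitrary: v)
  case 0
  then show ?case using assms price_nonneg by (auto simp: part_def)
next
  case (Suc j)
  have "rent j v X \<le> (\<Sum>u\<in>seg j ` part (Suc j) v X. charge j u Y)"
    unfolding rent_def by (intro sum_mono Suc)
  also have "\<dots> \<le> rent j v Y"
    unfolding rent_def using assms by (intro sum_mono2 charge_nonneg) (auto simp: part_def)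
  finally show ?case
    unfolding charge_Suc using infl_ge_1 cap_ge_1 by (intro min.mono mult_left_mono) auto
qed

lemma rent_mono: "finite Y \<Longrightarrow> X \<subseteq> Y \<Longrightarrow> rent j v X \<le> rent j v Y"
  unfolding rent_def
  by (rule order_trans[OF sum_mono[OF charge_mono]])
    (auto intro!: sum_mono2 charge_nonneg simp: part_def)

lemma total_charge_mono:
  assumes "finite Y" "X \<subseteq> Y"
  shows "total_charge k X \<le> total_charge k Y"
proof -
  have "total_charge k X \<le> (\<Sum>v\<in>seg k ` X. charge k v Y)"
    unfolding total_charge_def using assms by (intro sum_mono charge_mono)
  also have "\<dots> \<le> total_charge k Y"
    unfolding total_charge_def using assms by (intro sum_mono2 charge_nonneg) auto
  finally show ?thesis .
qed

lemma finite_respond: "finite (respond \<tau> k xs)"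
  by (simp add: respond_def Let_def finite_pack)

lemma finite_owned: "finite (owned \<tau> k v xs)"
  by (simp add: owned_def finite_respond)

lemma c_nonneg_respond: "l \<in> respond \<tau> k xs \<Longrightarrow> 0 \<le> c l"
  by (auto simp: respond_def Let_def intro: c_nonneg)

lemma c_nonneg_owned: "l \<in> owned \<tau> k v xs \<Longrightarrow> 0 \<le> c l"
  by (auto simp: owned_def intro: c_nonneg_respond)

lemma level_cong: "(\<And>j. j \<le> k \<Longrightarrow> \<tau> j = \<tau>' j) \<Longrightarrow> level \<tau> k X e = level \<tau>' k X e"
  by (induction k) auto

lemma owned_cong: "(\<And>j. j \<le> k \<Longrightarrow> \<tau> j = \<tau>' j) \<Longrightarrow> owned \<tau> k v xs = owned \<tau>' k v xs"
  unfolding owned_def respond_def using level_cong[of k \<tau> \<tau>'] by simp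

text \<open>Within a segment, the requests served below level \<open>Suc k\<close> form a prefix of the sequence.\<close>

lemma owned_Suc_cost:
  fixes t :: nat
  shows "\<exists>m\<le>length xs.
    rent k v (set (take m xs)) \<le> min (rent k v (set xs)) (real t * price (Suc k) v) \<and>
    (\<forall>\<tau>. \<tau> (Suc k) = t \<longrightarrow> sum c (owned \<tau> (Suc k) v xs) \<le>
       (if real t * price (Suc k) v \<le> rent k v (set xs) then price (Suc k) v else 0) +
       (\<Sum>u\<in>seg k ` part (Suc k) v (set (take m xs)). sum c (owned \<tau> k u (take m xs))))"
proof -
  define trig where "trig i \<longleftrightarrow> real t * price (Suc k) v \<le> rent k v (set (take i xs))" for i
  \<comment> \<open>The request with index \<open>m\<close> is the one at whose arrival
    \<open>trig\<close> first holds; \<open>take m xs\<close> excludes it, so its rent is still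
    within the threshold. Only \<open>t\<close> enters, not the thresholds below, hence one
    \<open>m\<close> serves all \<open>\<tau>\<close>.\<close>
  define m where "m = (if \<exists>i<length xs. trig (Suc i) then LEAST i. trig (Suc i) else length xs)"
  have trig_mono: "trig i \<Longrightarrow> i \<le> j \<Longrightarrow> trig j" for i j
    using rent_mono[of "set (take j xs)" "set (take i xs)" k v] set_take_subset_set_take[of i j xs]
    by (auto simp: trig_def)
  have m_le: "m \<le> length xs"
    unfolding m_def by (auto intro: order_trans[OF Least_le])
  have not_trig: "\<not> trig (Suc i)" if "i < m" for i
    using that not_less_Least[of i "\<lambda>i. trig (Suc i)"] m_le by (auto simp: m_def split: if_splits)
  have trig_from: "trig (Suc i)" if "m \<le> i" "i < length xs" for i
  proof -
    have "trig (Suc m)" using that LeastI_ex[of "\<lambda>i. trig (Suc i)"]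
      by (auto simp: m_def split: if_splits)
    then show ?thesis using trig_mono that by auto
  qed
  have 1: "rent k v (set (take m xs)) \<le> min (rent k v (set xs)) (real t * price (Suc k) v)"
  proof -
    have "rent k v (set (take m xs)) \<le> real t * price (Suc k) v"
    proof (cases m)
      case 0
      then show ?thesis using price_nonneg by (simp add: rent_def part_def)
    next
      case (Suc i)
      then show ?thesis using not_trig[of i] by (simp add: trig_def)
    qed
    then show ?thesis using rent_mono[of "set xs" "set (take m xs)" k v]
      by (simp add: set_take_subset)
  qed
  have 2: "sum c (owned \<tau> (Suc k) v xs) \<le>
       (if real t * price (Suc k) v \<le> rent k v (set xs) then price (Suc k) v else 0) +
       (\<Sum>u\<in>seg k ` part (Suc k) v (set (take m xs)). sum c (owned \<tau> k u (take m xs)))"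
    if \<tau>: "\<tau> (Suc k) = t" for \<tau>
  proof -
  define U where "U = seg k ` part (Suc k) v (set (take m xs))"
  define B where "B = (if real t * price (Suc k) v \<le> rent k v (set xs) then pack (Suc k) v else {})"
  have "owned \<tau> (Suc k) v xs \<subseteq> B \<union> (\<Union>u\<in>U. owned \<tau> k u (take m xs))"
  proof
    fix l assume "l \<in> owned \<tau> (Suc k) v xs"
    then obtain i where i: "i < length xs" "seg (Suc k) (xs ! i) = v"
        "l \<in> respond \<tau> (Suc k) (take (Suc i) xs)" by (auto simp: owned_def)
    have last: "last (take (Suc i) xs) = xs ! i" using i by (simp add: take_Suc_conv_app_nth)
    show "l \<in> B \<union> (\<Union>u\<in>U. owned \<tau> k u (take m xs))"
    proof (cases "m \<le> i")
      case True
      then have "trig (Suc i)" "trig (length xs)" using trig_from i trig_mono[of "Suc i" "length xs"] by auto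
      then show ?thesis using i last \<tau>
        by (auto simp: respond_def Let_def trig_def B_def)
    next
      case False
      then have "\<not> trig (Suc i)" using not_trig by auto
      then have "l \<in> respond \<tau> k (take (Suc i) xs)" using i last \<tau>
        by (auto simp: respond_def Let_def trig_def)
      moreover have "take (Suc i) (take m xs) = take (Suc i) xs" using False by (simp add: min_def)
      moreover have "take m xs ! i = xs ! i" using False by simp
      ultimately have "l \<in> owned \<tau> k (seg k (xs ! i)) (take m xs)"
        using False i unfolding owned_def by (intro UN_I[of i]) auto
      moreover have "xs ! i \<in> set (take m xs)"
        using False i(1) by (simp add: in_set_conv_nth) (metis not_le nth_take)
      then have "seg k (xs ! i) \<in> U"
        using i(2) unfolding U_def part_def by (intro imageI) simp
      ultimately show ?thesis by blast
    qed
  qed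
  then have "sum c (owned \<tau> (Suc k) v xs) \<le> sum c (B \<union> (\<Union>u\<in>U. owned \<tau> k u (take m xs)))"
    by (intro sum_mono2)
      (auto simp: B_def U_def part_def finite_owned finite_pack intro: c_nonneg c_nonneg_owned split: if_splits)
  also have "\<dots> \<le> sum c B + sum c (\<Union>u\<in>U. owned \<tau> k u (take m xs))"
    by (subst sum_Un) (auto simp: B_def U_def part_def finite_owned finite_pack
      intro!: sum_nonneg intro: c_nonneg c_nonneg_owned split: if_splits)
  also have "sum c (\<Union>u\<in>U. owned \<tau> k u (take m xs)) \<le> (\<Sum>u\<in>U. sum c (owned \<tau> k u (take m xs)))"
    by (intro sum_UN_le) (auto simp: U_def part_def finite_owned intro: c_nonneg_owned)
  finally have "sum c (owned \<tau> (Suc k) v xs) \<le>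
       (if real t * price (Suc k) v \<le> rent k v (set xs) then price (Suc k) v else 0) +
       (\<Sum>u\<in>U. sum c (owned \<tau> k u (take m xs)))"
    by (simp add: B_def price_def split: if_splits)
  then show ?thesis by (simp add: U_def)
  qed
  show ?thesis using m_le 1 2 by blast
qed

text \<open>Induction on the level, with the top threshold \<open>t\<close> fixed first. By
  \<open>owned_Suc_cost\<close> one pays the price if the rent reaches the threshold, plus the cost
  of the lower levels on a prefix; by induction the expectation of the latter is at most the rent of
  that prefix. Averaging over \<open>t\<close> is then the ski rental guarantee
  \<open>rental\<close>.\<close>

lemma expected_owned_le_charge:
  fixes q :: "nat pmf"
  assumes q: "finite (set_pmf q)"
    and rental: "\<And>R w. 0 \<le> R \<Longrightarrow> 0 \<le> w \<Longrightarrow>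
      measure_pmf.expectation q (\<lambda>t. min R (real t * w) + (if real t * w \<le> R then w else 0))
        \<le> min (infl * R) (cap * w)"
  shows "measure_pmf.expectation (Pi_pmf {1..k} 0 (\<lambda>_. q)) (\<lambda>\<tau>. sum c (owned \<tau> k v xs))
    \<le> charge k v (set xs)"
proof (induction k arbitrary: v xs)
  case 0
  have "sum c (owned \<tau> 0 v xs) \<le> charge 0 v (set xs)" for \<tau>
  proof (cases "part 0 v (set xs) = {}")
    case True
    then have "owned \<tau> 0 v xs = {}"
      by (auto simp: owned_def part_def dest: nth_mem)
    then show ?thesis using True by simp
  next
    case False
    have "owned \<tau> 0 v xs \<subseteq> pack 0 v"
      by (auto simp: owned_def respond_def take_Suc_conv_app_nth)
    then show ?thesis using False
      by (auto simp: price_def intro!: sum_mono2 finite_pack c_nonneg)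
  qed
  then show ?case by simp
next
  case (Suc k)
  let ?P = "Pi_pmf {1..k} 0 (\<lambda>_. q)"
  let ?w = "price (Suc k) v" and ?R = "rent k v (set xs)"
  have finP: "finite (set_pmf ?P)" by (rule finite_set_Pi_pmf) (auto intro: q)
  have inner: "measure_pmf.expectation ?P (\<lambda>\<tau>. sum c (owned (\<tau>(Suc k := t)) (Suc k) v xs))
      \<le> min ?R (real t * ?w) + (if real t * ?w \<le> ?R then ?w else 0)" for t
  proof -
    define D where "D = (if real t * ?w \<le> ?R then ?w else 0)"
    obtain m where "m \<le> length xs" and m: "rent k v (set (take m xs)) \<le> min ?R (real t * ?w)"
      "\<And>\<tau>. \<tau> (Suc k) = t \<Longrightarrow> sum c (owned \<tau> (Suc k) v xs) \<le> D +
       (\<Sum>u\<in>seg k ` part (Suc k) v (set (take m xs)). sum c (owned \<tau> k u (take m xs)))"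
      unfolding D_def
      using owned_Suc_cost[where k = k and v = v and xs = xs and t = t] by blast
    \<comment> \<open>Changing the threshold of level \<open>Suc k\<close> does not affect what the
      lower levels buy.\<close>
    have m2: "sum c (owned (\<tau>(Suc k := t)) (Suc k) v xs) \<le> D +
       (\<Sum>u\<in>seg k ` part (Suc k) v (set (take m xs)). sum c (owned \<tau> k u (take m xs)))" for \<tau>
      using m(2)[of "\<tau>(Suc k := t)"] owned_cong[of k "\<tau>(Suc k := t)" \<tau>] by simp
    have "measure_pmf.expectation ?P (\<lambda>\<tau>. sum c (owned (\<tau>(Suc k := t)) (Suc k) v xs))
      \<le> measure_pmf.expectation ?P (\<lambda>\<tau>. D +
       (\<Sum>u\<in>seg k ` part (Suc k) v (set (take m xs)). sum c (owned \<tau> k u (take m xs))))"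
      by (intro expectation_mono_finite finP m2)
    also have "\<dots> = D + (\<Sum>u\<in>seg k ` part (Suc k) v (set (take m xs)).
        measure_pmf.expectation ?P (\<lambda>\<tau>. sum c (owned \<tau> k u (take m xs))))"
      using expectation_sum_finite[OF finP] integrable_measure_pmf_finite[OF finP]
      by (subst Bochner_Integration.integral_add) simp_all
    also have "\<dots> \<le> D + rent k v (set (take m xs))"
      unfolding rent_def by (intro add_left_mono sum_mono Suc)
    finally show ?thesis using m(1) unfolding D_def by linarith
  qed
  have "{1..Suc k} = insert (Suc k) {1..k}" by auto
  then have "measure_pmf.expectation (Pi_pmf {1..Suc k} 0 (\<lambda>_. q)) (\<lambda>\<tau>. sum c (owned \<tau> (Suc k) v xs))
    = measure_pmf.expectation q (\<lambda>t. measure_pmf.expectation ?P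
         (\<lambda>\<tau>. sum c (owned (\<tau>(Suc k := t)) (Suc k) v xs)))"
    by (simp add: expectation_Pi_pmf_insert q)
  also have "\<dots> \<le> measure_pmf.expectation q
      (\<lambda>t. min ?R (real t * ?w) + (if real t * ?w \<le> ?R then ?w else 0))"
    by (intro expectation_mono_finite q inner)
  also have "\<dots> \<le> charge (Suc k) v (set xs)"
    unfolding charge_Suc by (intro rental rent_nonneg price_nonneg)
  finally show ?case .
qed

lemma expected_purchased_le_total_charge:
  fixes q :: "nat pmf"
  assumes q: "finite (set_pmf q)"
    and rental: "\<And>R w. 0 \<le> R \<Longrightarrow> 0 \<le> w \<Longrightarrow>
      measure_pmf.expectation q (\<lambda>t. min R (real t * w) + (if real t * w \<le> R then w else 0))
        \<le> min (infl * R) (cap * w)"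
  shows "measure_pmf.expectation (Pi_pmf {1..k} 0 (\<lambda>_. q)) (\<lambda>\<tau>. sum c (purchased (respond \<tau> k) xs))
    \<le> total_charge k (set xs)"
proof -
  let ?P = "Pi_pmf {1..k} 0 (\<lambda>_. q)"
  have finP: "finite (set_pmf ?P)" by (rule finite_set_Pi_pmf) (auto intro: q)
  have "sum c (purchased (respond \<tau> k) xs) \<le> (\<Sum>v\<in>seg k ` set xs. sum c (owned \<tau> k v xs))" for \<tau>
  proof -
    have "purchased (respond \<tau> k) xs = (\<Union>v\<in>seg k ` set xs. owned \<tau> k v xs)"
      by (auto simp: purchased_def owned_def intro: nth_mem)
    then show ?thesis
      by (simp only:) (intro sum_UN_le finite_owned c_nonneg_owned finite_imageI finite_set)
  qed
  then have "measure_pmf.expectation ?P (\<lambda>\<tau>. sum c (purchased (respond \<tau> k) xs))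
      \<le> measure_pmf.expectation ?P (\<lambda>\<tau>. \<Sum>v\<in>seg k ` set xs. sum c (owned \<tau> k v xs))"
    by (intro expectation_mono_finite finP)
  also have "\<dots> = (\<Sum>v\<in>seg k ` set xs. measure_pmf.expectation ?P (\<lambda>\<tau>. sum c (owned \<tau> k v xs)))"
    by (rule expectation_sum_finite[OF finP])
  also have "\<dots> \<le> total_charge k (set xs)"
    unfolding total_charge_def by (intro sum_mono expected_owned_le_charge q rental)
  finally show ?thesis .
qed

text \<open>The sets \<open>A j\<close> stand for the segments that a competing solution uses. Going
  down from the top, a segment in \<open>A j\<close> is charged against buying, at the factor
  \<open>cap\<close>; any other is charged against renting, which hands its requests to the level
  below at the factor \<open>infl\<close>. There are at most \<open>k\<close> such descents.\<close>

lemma total_charge_le: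
  assumes "finite X" "\<And>j. j \<le> k \<Longrightarrow> finite (A j)" "\<And>e. e \<in> X \<Longrightarrow> \<exists>j\<le>k. seg j e \<in> A j"
  shows "total_charge k X \<le> infl ^ k * (cap * (\<Sum>j\<le>k. \<Sum>v\<in>A j. price j v))"
  using assms
proof (induction k arbitrary: X)
  case 0
  have "total_charge 0 X \<le> (\<Sum>v\<in>seg 0 ` X. price 0 v)"
    unfolding total_charge_def by (intro sum_mono) (auto simp: price_nonneg)
  also have "\<dots> \<le> (\<Sum>v\<in>A 0. price 0 v)"
    using 0 by (intro sum_mono2) (auto simp: price_nonneg)
  also have "\<dots> \<le> cap * (\<Sum>v\<in>A 0. price 0 v)"
    using mult_right_mono[OF cap_ge_1] by (simp add: sum_nonneg price_nonneg)
  finally show ?case by simp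
next
  case (Suc k)
  define Y where "Y = {e \<in> X. seg (Suc k) e \<notin> A (Suc k)}"
  define S where "S = (\<Sum>j\<le>k. \<Sum>v\<in>A j. price j v)"
  have IH: "total_charge k Y \<le> infl ^ k * (cap * S)"
    unfolding S_def
  proof (rule Suc.IH)
    fix e assume "e \<in> Y"
    then obtain j where "j \<le> Suc k" "seg j e \<in> A j" "seg (Suc k) e \<notin> A (Suc k)"
      using Suc.prems(3)[of e] by (auto simp: Y_def)
    then show "\<exists>j\<le>k. seg j e \<in> A j" by (intro exI[of _ j]) (auto simp: le_Suc_eq)
  qed (use Suc.prems in \<open>auto simp: Y_def\<close>)
  have split: "seg (Suc k) ` X = (seg (Suc k) ` X \<inter> A (Suc k)) \<union> seg (Suc k) ` Y"
    by (auto simp: Y_def)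
  have disj: "(seg (Suc k) ` X \<inter> A (Suc k)) \<inter> seg (Suc k) ` Y = {}" by (auto simp: Y_def)
  \<comment> \<open>Requests are removed by whole top segments, so a top segment that still meets
    \<open>Y\<close> has kept all its requests.\<close>
  have rent_Y: "rent k v X = (\<Sum>u\<in>seg k ` part (Suc k) v Y. charge k u Y)"
    if "v \<in> seg (Suc k) ` Y" for v
  proof -
    have eq: "part (Suc k) v X = part (Suc k) v Y" using that by (auto simp: part_def Y_def)
    have "charge k u X = charge k u Y" if "u \<in> seg k ` part (Suc k) v Y" for u
      by (rule charge_cong) (use part_nested[of u k v] that eq in metis)
    then show ?thesis by (simp add: rent_def eq)
  qed
  \<comment> \<open>Each segment of level \<open>k\<close> has only one parent, so the sum over all
    children of all parents counts it once.\<close>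
  have disj_parts: "seg k ` part (Suc k) v Y \<inter> seg k ` part (Suc k) w Y = {}" if "v \<noteq> w" for v w
    using nested[of k] that unfolding part_def by blast
  have "(\<Sum>v\<in>seg (Suc k) ` Y. charge (Suc k) v X)
      \<le> (\<Sum>v\<in>seg (Suc k) ` Y. infl * (\<Sum>u\<in>seg k ` part (Suc k) v Y. charge k u Y))"
    by (intro sum_mono) (simp only: charge_Suc rent_Y min.cobounded1)
  also have "\<dots> = infl * (\<Sum>v\<in>seg (Suc k) ` Y. \<Sum>u\<in>seg k ` part (Suc k) v Y. charge k u Y)"
    by (rule sum_distrib_left[symmetric])
  also have "(\<Sum>v\<in>seg (Suc k) ` Y. \<Sum>u\<in>seg k ` part (Suc k) v Y. charge k u Y)
      = (\<Sum>u\<in>(\<Union>v\<in>seg (Suc k) ` Y. seg k ` part (Suc k) v Y). charge k u Y)"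
    using Suc.prems(1) disj_parts
    by (intro sum.UNION_disjoint[symmetric] ballI impI) (simp_all add: Y_def part_def)
  also have "(\<Union>v\<in>seg (Suc k) ` Y. seg k ` part (Suc k) v Y) = seg k ` Y"
    by (auto simp: part_def)
  finally have 1: "(\<Sum>v\<in>seg (Suc k) ` Y. charge (Suc k) v X) \<le> infl * total_charge k Y"
    by (simp add: total_charge_def)
  have "(\<Sum>v\<in>seg (Suc k) ` X \<inter> A (Suc k). charge (Suc k) v X)
      \<le> (\<Sum>v\<in>seg (Suc k) ` X \<inter> A (Suc k). cap * price (Suc k) v)"
    by (intro sum_mono) (simp only: charge_Suc min.cobounded2)
  also have "\<dots> \<le> (\<Sum>v\<in>A (Suc k). cap * price (Suc k) v)"
    using Suc.prems(2)[of "Suc k"] cap_ge_1 by (intro sum_mono2) (auto simp: price_nonneg)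
  also have "\<dots> = cap * (\<Sum>v\<in>A (Suc k). price (Suc k) v)"
    by (rule sum_distrib_left[symmetric])
  also have "\<dots> \<le> infl ^ Suc k * (cap * (\<Sum>v\<in>A (Suc k). price (Suc k) v))"
    using mult_right_mono[OF one_le_power[OF infl_ge_1, of "Suc k"]] cap_ge_1
    by (simp add: sum_nonneg price_nonneg del: power_Suc)
  finally have 2: "(\<Sum>v\<in>seg (Suc k) ` X \<inter> A (Suc k). charge (Suc k) v X)
      \<le> infl ^ Suc k * (cap * (\<Sum>v\<in>A (Suc k). price (Suc k) v))" .
  have "total_charge (Suc k) X = (\<Sum>v\<in>seg (Suc k) ` X \<inter> A (Suc k). charge (Suc k) v X)
      + (\<Sum>v\<in>seg (Suc k) ` Y. charge (Suc k) v X)"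
    unfolding total_charge_def using Suc.prems(1) disj
    by (subst split, subst sum.union_disjoint) (auto simp: Y_def)
  also have "\<dots> \<le> infl ^ Suc k * (cap * (\<Sum>v\<in>A (Suc k). price (Suc k) v))
      + infl * (infl ^ k * (cap * S))"
    using 1 2 mult_left_mono[OF IH, of infl] infl_ge_1 by linarith
  finally show ?case by (simp add: S_def algebra_simps)
qed

end

section \<open>Segments of the path\<close>

text \<open>Scans the path from the left and represents a segment by its first element. A segment
  can open only where one of \<open>f\<close> does, and opens there unless \<open>R\<close> joins
  that position to the start of the current segment. Position \<open>0\<close> lies before the
  path.\<close>

primrec greedy :: "(nat \<Rightarrow> nat) \<Rightarrow> (nat \<Rightarrow> nat \<Rightarrow> bool) \<Rightarrow> nat \<Rightarrow> nat" where
  "greedy f R 0 = 0"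
| "greedy f R (Suc e) =
     (if f (Suc e) = Suc e \<and> \<not> R (greedy f R e) (Suc e) then Suc e else greedy f R e)"

text \<open>Such a map sends every element to the start of its segment; its fixed points are the
  starts.\<close>

definition segmentation :: "(nat \<Rightarrow> nat) \<Rightarrow> bool" where
  "segmentation f \<longleftrightarrow> mono f \<and> (\<forall>e. f e \<le> e \<and> f (f e) = f e)"

lemma greedy_le: "greedy f R e \<le> e"
  by (induction e) auto

lemma greedy_step_mono: "greedy f R e \<le> greedy f R (Suc e)"
  using greedy_le[of f R e] by auto

lemma segmentation_greedy: "segmentation (greedy f R)"
proof -
  have "greedy f R (greedy f R e) = greedy f R e" for e
    by (induction e) auto
  moreover have "mono (greedy f R)"
    unfolding mono_iff_le_Suc using greedy_step_mono by blast
  ultimately show ?thesis by (simp add: segmentation_def greedy_le)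
qed

lemma segmentationD:
  assumes "segmentation f"
  shows "f e \<le> e" "f (f e) = f e" "x \<le> y \<Longrightarrow> f x \<le> f y"
  using assms by (auto simp: segmentation_def dest: monoD)

lemma segmentation_between:
  assumes "segmentation f" "f e \<le> p" "p \<le> e"
  shows "f p = f e"
proof (rule antisym)
  show "f p \<le> f e" by (rule segmentationD(3)[OF assms(1,3)])
  have "f (f e) \<le> f p" by (rule segmentationD(3)[OF assms(1,2)])
  then show "f e \<le> f p" by (simp only: segmentationD(2)[OF assms(1)])
qed

text \<open>Within a segment of \<open>f\<close> only the start is a fixed point of
  \<open>f\<close>, so the scan opens nothing after it. Hence the greedy segmentation coarsens
  \<open>f\<close>.\<close>

lemma greedy_start:
  assumes "segmentation f"
  shows "greedy f R (f e) = greedy f R e"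
proof -
  have "greedy f R p = greedy f R (f e)" if "f e \<le> p" "p \<le> e" for p
    using that
  proof (induction p rule: dec_induct)
    case (step p)
    have "f (Suc p) = f e" using step by (intro segmentation_between assms) auto
    then have "f (Suc p) \<noteq> Suc p" using step by auto
    then show ?case using step by simp
  qed simp
  from this[of e] show ?thesis using segmentationD(1)[OF assms, of e] by simp
qed

lemma greedy_joined:
  assumes "f p = p" "greedy f R p < p"
  shows "R (greedy f R p) p"
  using assms by (cases p) (auto split: if_splits)

text \<open>A segment that starts inside the interval cannot close before \<open>b\<close>, because
  its start is related to every later position up to \<open>b\<close>. So at most one segment
  besides that of \<open>a\<close> meets the interval.\<close>

lemma greedy_interval:
  assumes "\<And>x y. x \<in> {a..b} \<Longrightarrow> y \<in> {a..b} \<Longrightarrow> R x y" "e \<in> {a..b}"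
  shows "greedy f R e = greedy f R a \<or> greedy f R e = greedy f R b"
proof (cases "greedy f R e = greedy f R a")
  case False
  let ?g = "greedy f R"
  have seg: "segmentation ?g" by (rule segmentation_greedy)
  have "a < ?g e"
  proof (rule ccontr)
    assume "\<not> a < ?g e"
    then show False using segmentation_between[OF seg, of e a] False assms(2) by simp
  qed
  moreover have "?g e \<le> e" by (rule greedy_le)
  ultimately have s: "?g e \<in> {a..b}" using assms(2) by auto
  have "?g p = ?g e" if "?g e \<le> p" "p \<le> b" for p
    using that
  proof (induction p rule: dec_induct)
    case base
    show ?case by (rule segmentationD(2)[OF seg])
  next
    case (step p)
    then have "R (?g p) (Suc p)" using assms(1)[of "?g e" "Suc p"] s by auto
    then show ?case using step by simp
  qed
  from this[of b] show ?thesis using assms(2) \<open>?g e \<le> e\<close> by simp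
qed simp

section \<open>Segmentations induced by cheap links\<close>

definition joined :: "'l wpap \<Rightarrow> real \<Rightarrow> nat \<Rightarrow> nat \<Rightarrow> bool" where
  "joined I b x y \<longleftrightarrow> (\<exists>l\<in>links I. cost I l \<le> b \<and> x \<in> cover I l \<and> y \<in> cover I l)"

text \<open>Scanning over the starts of the previous level, instead of over all elements, is what
  makes the levels nested.\<close>

primrec start :: "'l wpap \<Rightarrow> real \<Rightarrow> nat \<Rightarrow> nat \<Rightarrow> nat" where
  "start I u 0 = (\<lambda>e. e)"
| "start I u (Suc j) = greedy (start I u j) (joined I (u * 8 ^ Suc j))"

lemma segmentation_start: "segmentation (start I u j)"
  by (cases j) (auto simp: segmentation_greedy, auto simp: segmentation_def mono_def)

lemma start_nested: "start I u j x = start I u j y \<Longrightarrow> start I u (Suc j) x = start I u (Suc j) y"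
  using greedy_start[OF segmentation_start, of I u j] by (metis start.simps(2))

section \<open>Link sets, their costs and optimal covers\<close>

lemma cover_interval:
  assumes "I \<in> wpap_instances" "l \<in> links I"
  obtains a b where "cover I l = {a..b}" "a \<le> b"
  using assms by (auto simp: wpap_instances_def)

lemma finite_links: "I \<in> wpap_instances \<Longrightarrow> finite (links I)"
  by (simp add: wpap_instances_def)

lemma cost_nonneg: "I \<in> wpap_instances \<Longrightarrow> l \<in> links I \<Longrightarrow> 0 \<le> cost I l"
  by (simp add: wpap_instances_def)

lemma covered_subset_elems: "I \<in> wpap_instances \<Longrightarrow> F \<subseteq> links I \<Longrightarrow> covered I F \<subseteq> elems I"
  by (fastforce simp: wpap_instances_def covered_def elems_def)

lemma total_cost_nonneg: "I \<in> wpap_instances \<Longrightarrow> F \<subseteq> links I \<Longrightarrow> 0 \<le> total_cost I F"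
  by (auto simp: total_cost_def intro!: sum_nonneg cost_nonneg)

lemma total_cost_mono:
  "I \<in> wpap_instances \<Longrightarrow> F \<subseteq> F' \<Longrightarrow> F' \<subseteq> links I \<Longrightarrow> total_cost I F \<le> total_cost I F'"
  unfolding total_cost_def
  by (rule sum_mono2) (auto intro: cost_nonneg finite_subset finite_links)

lemma total_cost_Un:
  assumes "I \<in> wpap_instances" "F \<subseteq> links I" "F' \<subseteq> links I"
  shows "total_cost I (F \<union> F') \<le> total_cost I F + total_cost I F'"
proof -
  have "finite F" "finite F'" using assms finite_links finite_subset by blast+
  then show ?thesis using total_cost_nonneg[of I "F \<inter> F'"] assms
    by (auto simp: total_cost_def sum_Un)
qed

lemma cost_le_total_cost:
  "I \<in> wpap_instances \<Longrightarrow> F \<subseteq> links I \<Longrightarrow> l \<in> F \<Longrightarrow> cost I l \<le> total_cost I F"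
  using total_cost_mono[of I "{l}" F] by (simp add: total_cost_def)

lemma opt_le:
  assumes "I \<in> wpap_instances" "F \<subseteq> links I" "X \<subseteq> covered I F"
  shows "opt I X \<le> total_cost I F"
  unfolding opt_def using assms finite_links[of I] by (intro Min_le) auto

lemma opt_attained:
  assumes "I \<in> wpap_instances" "X \<subseteq> covered I (links I)"
  shows "\<exists>F. F \<subseteq> links I \<and> X \<subseteq> covered I F \<and> total_cost I F = opt I X"
proof -
  have "opt I X \<in> total_cost I ` {F. F \<subseteq> links I \<and> X \<subseteq> covered I F}"
    unfolding opt_def using assms finite_links[of I] by (intro Min_in) auto
  then show ?thesis by auto
qed

definition best_cover :: "'l wpap \<Rightarrow> nat set \<Rightarrow> 'l set" where
  "best_cover I X = (SOME F. F \<subseteq> links I \<and> X \<subseteq> covered I F \<and> total_cost I F = opt I X)"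

lemma best_cover:
  assumes "I \<in> wpap_instances" "X \<subseteq> covered I (links I)"
  shows "best_cover I X \<subseteq> links I" "X \<subseteq> covered I (best_cover I X)"
    "total_cost I (best_cover I X) = opt I X"
  using someI_ex[OF opt_attained[OF assms]] by (auto simp: best_cover_def)

lemma opt_nonneg: "I \<in> wpap_instances \<Longrightarrow> X \<subseteq> covered I (links I) \<Longrightarrow> 0 \<le> opt I X"
  using best_cover total_cost_nonneg by metis

lemma opt_mono:
  assumes "I \<in> wpap_instances" "X \<subseteq> Y" "Y \<subseteq> covered I (links I)"
  shows "opt I X \<le> opt I Y"
  using opt_le[OF assms(1), of "best_cover I Y" X] best_cover[OF assms(1,3)] assms(2) by auto

lemma opt_insert_link:
  assumes "I \<in> wpap_instances" "l \<in> links I" "Z \<subseteq> covered I (links I)" "Y \<subseteq> cover I l \<union> Z"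
  shows "opt I Y \<le> cost I l + opt I Z"
proof -
  have "opt I Y \<le> total_cost I ({l} \<union> best_cover I Z)"
    using assms best_cover[OF assms(1,3)] by (intro opt_le) (auto simp: covered_def)
  also have "\<dots> \<le> total_cost I {l} + total_cost I (best_cover I Z)"
    using assms best_cover[OF assms(1,3)] by (intro total_cost_Un) auto
  finally show ?thesis using best_cover[OF assms(1,3)] by (simp add: total_cost_def)
qed

lemma opt_empty: "I \<in> wpap_instances \<Longrightarrow> opt I {} = 0"
  using opt_le[of I "{}" "{}"] opt_nonneg[of I "{}"] by (simp add: total_cost_def)

text \<open>Elements on no link are left out, since \<open>opt\<close> is meaningful only for sets
  that can be covered.\<close>

definition segment :: "'l wpap \<Rightarrow> real \<Rightarrow> nat \<Rightarrow> nat \<Rightarrow> nat set" where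
  "segment I u j s = {e \<in> covered I (links I). start I u j e = s}"

lemma segment_coverable: "segment I u j s \<subseteq> covered I (links I)"
  by (auto simp: segment_def)

text \<open>A segment of level \<open>Suc j\<close> consists of a part within one link of cost at most
  \<open>u * 8 ^ Suc j\<close> and a single segment of level \<open>j\<close> at its right end.\<close>

lemma opt_segment:
  assumes I: "I \<in> wpap_instances" and u: "0 \<le> u"
  shows "opt I (segment I u j s) \<le> 2 * (u * 8 ^ j) \<or> segment I u j s \<subseteq> {s}"
proof (induction j arbitrary: s)
  case 0
  then show ?case by (auto simp: segment_def)
next
  case (Suc j)
  let ?f = "start I u j" and ?g = "start I u (Suc j)"
  let ?Q = "segment I u (Suc j) s"
  have f: "segmentation ?f" and g: "segmentation ?g" by (rule segmentation_start)+
  \<comment> \<open>This leaves room for one piece of level \<open>j\<close> next to a link of cost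
    at most \<open>u * 8 ^ Suc j\<close>.\<close>
  have u2: "2 * (u * 8 ^ j) \<le> u * 8 ^ Suc j" using u by simp
  have nonneg: "0 \<le> u * 8 ^ Suc j" using u by simp
  show ?case
  proof (cases "?Q = {}")
    case False
    have fin: "finite ?Q"
      using covered_subset_elems[OF I order_refl] finite_subset[of ?Q "elems I"]
      by (auto simp: segment_def elems_def)
    \<comment> \<open>\<open>M\<close> is the last element and \<open>p\<close> the start of its
      segment of level \<open>j\<close>. The elements from \<open>p\<close> on belong to that one
      piece; if \<open>s\<close> differs from \<open>p\<close>, those from \<open>s\<close> to
      \<open>p\<close> lie on the link because of which the scan merged \<open>p\<close> into the
      segment of \<open>s\<close>.\<close>
    define M where "M = Max ?Q"
    define p where "p = ?f M"
    have M: "M \<in> ?Q" "\<And>e. e \<in> ?Q \<Longrightarrow> e \<le> M" using fin False by (auto simp: M_def)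
    have fp: "?f p = p" unfolding p_def by (rule segmentationD(2)[OF f])
    have gp: "?g p = s"
      using greedy_start[OF f] M(1) by (simp add: p_def segment_def)
    have sp: "s \<le> p" using segmentationD(1)[OF g, of p] gp by simp
    have se: "s \<le> e" if "e \<in> ?Q" for e
      using segmentationD(1)[OF g, of e] that by (simp add: segment_def)
    have piece: "?f e = p" if "e \<in> ?Q" "p \<le> e" for e
      using segmentation_between[OF f, of M e] that M(2)[of e] by (simp add: p_def)
    show ?thesis
    proof (cases "s = p")
      case True
      have "?Q \<subseteq> segment I u j s" using piece se True by (auto simp: segment_def)
      note sub = this
      show ?thesis using Suc[of s]
      proof
        assume "opt I (segment I u j s) \<le> 2 * (u * 8 ^ j)"
        then show ?thesis using opt_mono[OF I sub segment_coverable] u2 nonneg by linarith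
      next
        assume "segment I u j s \<subseteq> {s}"
        then show ?thesis using sub by (intro disjI2 subset_trans[OF sub])
      qed
    next
      case False
      then have "joined I (u * 8 ^ Suc j) s p"
        using greedy_joined[of ?f p "joined I (u * 8 ^ Suc j)"] fp gp sp by simp
      then obtain l where l: "l \<in> links I" "cost I l \<le> u * 8 ^ Suc j" "s \<in> cover I l" "p \<in> cover I l"
        by (auto simp: joined_def)
      have between: "e \<in> cover I l" if "s \<le> e" "e \<le> p" for e
        using l that cover_interval[OF I l(1)] by (metis atLeastAtMost_iff order_trans)
      have "opt I ?Q \<le> 2 * (u * 8 ^ Suc j)"
      proof (cases "segment I u j p \<subseteq> {p}")
        case True
        \<comment> \<open>The induction hypothesis does not bound the price of a lone
          \<open>p\<close>, but \<open>l\<close> covers \<open>p\<close> as well.\<close>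
        have "?Q \<subseteq> cover I l \<union> {}"
          using se piece between True by (fastforce simp: segment_def)
        then have "opt I ?Q \<le> cost I l + opt I {}" by (intro opt_insert_link I l) auto
        then show ?thesis using l(2) nonneg by (simp only: opt_empty[OF I])
      next
        case False
        have "?Q \<subseteq> cover I l \<union> segment I u j p"
          using se piece between by (fastforce simp: segment_def)
        then have "opt I ?Q \<le> cost I l + opt I (segment I u j p)"
          by (intro opt_insert_link I l segment_coverable)
        then show ?thesis using False Suc[of p] l(2) u2 by linarith
      qed
      then show ?thesis ..
    qed
  qed simp
qed

text \<open>The exception in \<open>opt_segment\<close> is a lone element, which is harmless when it
  lies on a cheap link.\<close>

lemma opt_segment_link:
  assumes I: "I \<in> wpap_instances" and u: "0 \<le> u" and l: "l \<in> links I" "cost I l \<le> u * 8 ^ j"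
    and e: "e \<in> cover I l"
  shows "opt I (segment I u j (start I u j e)) \<le> 2 * (u * 8 ^ j)"
proof (cases "segment I u j (start I u j e) \<subseteq> {start I u j e}")
  case True
  have "e \<in> segment I u j (start I u j e)" using l e by (auto simp: segment_def covered_def)
  then have "start I u j e = e" using True by auto
  then have "segment I u j (start I u j e) \<subseteq> cover I l \<union> {}" using True e by auto
  then have "opt I (segment I u j (start I u j e)) \<le> cost I l + opt I {}"
    by (intro opt_insert_link I l) auto
  then show ?thesis using l(2) cost_nonneg[OF I l(1)] by (simp only: opt_empty[OF I])
next
  case False
  then show ?thesis using opt_segment[OF I u] by blast
qed

text \<open>Any two elements of such a link are joined at this level, so
  \<open>greedy_interval\<close> applies. Level \<open>0\<close> is excluded: there a link meets as
  many segments as it has elements.\<close>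

lemma card_start_cover:
  assumes I: "I \<in> wpap_instances" and l: "l \<in> links I" "cost I l \<le> u * 8 ^ Suc j"
  shows "card (start I u (Suc j) ` cover I l) \<le> 2"
proof -
  obtain a b where ab: "cover I l = {a..b}" "a \<le> b" using cover_interval[OF I l(1)] .
  have "start I u (Suc j) ` cover I l \<subseteq> {start I u (Suc j) a, start I u (Suc j) b}"
    using greedy_interval[of a b "joined I (u * 8 ^ Suc j)" _ "start I u j"] l ab
    by (fastforce simp: joined_def)
  then have "card (start I u (Suc j) ` cover I l) \<le> card {start I u (Suc j) a, start I u (Suc j) b}"
    by (intro card_mono) auto
  also have "\<dots> \<le> 2" by (simp add: card_insert_if)
  finally show ?thesis .
qed

definition segment_cover :: "'l wpap \<Rightarrow> real \<Rightarrow> nat \<Rightarrow> nat \<Rightarrow> 'l set" where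
  "segment_cover I u j s = best_cover I (segment I u j s)"

lemma rental_hierarchy_segments:
  assumes "I \<in> wpap_instances" "1 \<le> infl" "1 \<le> cap"
  shows "rental_hierarchy (start I u) (segment_cover I u) (cost I) infl cap"
proof
  have sub: "segment_cover I u j v \<subseteq> links I" for j v
    unfolding segment_cover_def by (intro best_cover assms segment_coverable)
  show "finite (segment_cover I u j v)" for j v
    using sub finite_subset finite_links[OF assms(1)] by blast
  show "0 \<le> cost I l" if "l \<in> segment_cover I u j v" for l j v
    using sub that cost_nonneg[OF assms(1)] by blast
qed (use assms start_nested in auto)

text \<open>Comparison with an optimal cover \<open>F\<close> by \<open>total_charge_le\<close>. A
  link of cost above \<open>u * 8 ^ (j - 1)\<close> and at most \<open>u * 8 ^ j\<close>, where
  \<open>j > 1\<close>, is charged at level \<open>j\<close>: it meets at most two segments of price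
  at most \<open>2 * u * 8 ^ j\<close>, together \<open>32 * u * 8 ^ (j - 1)\<close>, which is at
  most 32 times its cost. Links of cost at most \<open>8 * u\<close> are charged at level
  \<open>1\<close> per request: \<open>16 * u\<close> for each of at most \<open>2 ^ K\<close>
  requests, in total \<open>16 * G / 4 ^ K\<close>.\<close>

lemma total_charge_bound:
  assumes I: "I \<in> wpap_instances" and G: "0 < G" and K: "1 \<le> K" and cap: "1 \<le> cap"
    and X: "X \<subseteq> covered I (links I)" "opt I X \<le> G" "card X \<le> 2 ^ K"
  shows "rental_hierarchy.total_charge (start I (G / 8 ^ K)) (segment_cover I (G / 8 ^ K)) (cost I)
      (1 + 1 / real K) cap K X \<le> 3 * cap * (32 * opt I X + 16 * (G / 4 ^ K))"
proof -
  define u where "u = G / 8 ^ K"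
  have u: "0 < u" using G by (simp add: u_def)
  interpret rental_hierarchy "start I u" "segment_cover I u" "cost I" "1 + 1 / real K" cap
    using I cap by (intro rental_hierarchy_segments) auto
  have price: "price j v = opt I (segment I u j v)" for j v
    using best_cover(3)[OF I segment_coverable]
    by (simp add: price_def segment_cover_def total_cost_def)
  define F where "F = best_cover I X"
  have F: "F \<subseteq> links I" "X \<subseteq> covered I F" "total_cost I F = opt I X"
    using best_cover[OF I X(1)] by (auto simp: F_def)
  have finF: "finite F" using F(1) finite_links[OF I] finite_subset by blast
  have finX: "finite X"
    using X(1) covered_subset_elems[OF I order_refl] finite_subset[of X "elems I"]
      by (auto simp: elems_def)
  have cost0: "0 \<le> cost I l" if "l \<in> F" for l using cost_nonneg[OF I] F(1) that by blast
  define cls where "cls j l \<longleftrightarrow> 1 < j \<and> u * 8 ^ (j - 1) < cost I l \<and> cost I l \<le> u * 8 ^ j" for j l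
  define A where "A j = start I u j `
    {e \<in> X. \<exists>l\<in>F. e \<in> cover I l \<and> (j = 1 \<and> cost I l \<le> u * 8 \<or> cls j l)}" for j
  have finA: "finite (A j)" for j using finX by (simp add: A_def)
  have cov: "\<exists>j\<le>K. start I u j e \<in> A j" if "e \<in> X" for e
  proof -
    obtain l where l: "l \<in> F" "e \<in> cover I l" using F(2) \<open>e \<in> X\<close> by (auto simp: covered_def)
    define j where "j = (LEAST j. 1 \<le> j \<and> cost I l \<le> u * 8 ^ j)"
    \<comment> \<open>The top level reaches cost \<open>G\<close>, which bounds the optimum, so
      every link of \<open>F\<close> finds a level.\<close>
    have "cost I l \<le> u * 8 ^ K"
      using cost_le_total_cost[OF I F(1) l(1)] F(3) X(2) by (simp add: u_def)
    then have j: "1 \<le> j \<and> cost I l \<le> u * 8 ^ j" "j \<le> K"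
      using K LeastI[of "\<lambda>j. 1 \<le> j \<and> cost I l \<le> u * 8 ^ j" K] Least_le[of _ K] by (auto simp: j_def)
    have "cls j l" if "j \<noteq> 1"
      using not_less_Least[of "j - 1" "\<lambda>j. 1 \<le> j \<and> cost I l \<le> u * 8 ^ j", folded j_def] that j
      by (auto simp: cls_def)
    moreover have "cost I l \<le> u * 8" if "j = 1" using j(1) that by simp
    ultimately have "start I u j e \<in> A j"
      unfolding A_def using l \<open>e \<in> X\<close> by (intro imageI) blast
    then show ?thesis using j(2) by blast
  qed
  have price_le: "price j v \<le> 2 * (u * 8 ^ j)" if "v \<in> A j" for j v
  proof -
    obtain e l where "v = start I u j e" "l \<in> F" "e \<in> cover I l" "cost I l \<le> u * 8 ^ j"
      using \<open>v \<in> A j\<close> by (auto simp: A_def cls_def)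
    then show ?thesis unfolding price using opt_segment_link[OF I] u F(1) by auto
  qed
  have level_le: "(\<Sum>v\<in>A j. price j v) \<le>
      (if j = 1 then 16 * u * card X else 0) + (\<Sum>l\<in>F. if cls j l then 32 * cost I l else 0)" for j
  proof (cases "j = 1")
    case True
    have "(\<Sum>v\<in>A j. price j v) \<le> (\<Sum>v\<in>A j. 2 * (u * 8 ^ j))" by (intro sum_mono price_le)
    also have "\<dots> = 16 * u * card (A j)" using True by simp
    also have "\<dots> \<le> 16 * u * card X"
      using u card_image_le[OF finX] card_mono[OF finX]
      unfolding A_def
        by (intro mult_left_mono) (auto intro!: order_trans[OF card_image_le] simp: finX card_mono)
    finally show ?thesis using True by (simp add: cls_def)
  next
    case False
    define C where "C = {l \<in> F. cls j l}"
    have finC: "finite C" using finF by (simp add: C_def)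
    show ?thesis
    proof (cases "j = 0")
      case True
      then have "A j = {}" by (auto simp: A_def cls_def)
      then show ?thesis using \<open>j \<noteq> 1\<close> cost0 by (auto intro!: sum_nonneg)
    next
      case False
      then obtain i where i: "j = Suc i" by (cases j) auto
      have "A j \<subseteq> (\<Union>l\<in>C. start I u j ` cover I l)"
        using \<open>j \<noteq> 1\<close> by (auto simp: A_def C_def)
      moreover have fin: "finite (cover I l)" if "l \<in> C" for l
        using that cover_interval[OF I, of l] F(1) unfolding C_def
          by (metis (no_types, lifting) finite_atLeastAtMost mem_Collect_eq subsetD)
      ultimately have "card (A j) \<le> card (\<Union>l\<in>C. start I u j ` cover I l)"
        using finC by (intro card_mono) auto
      also have "\<dots> \<le> (\<Sum>l\<in>C. card (start I u j ` cover I l))"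
        by (rule card_UN_le[OF finC])
      also have "\<dots> \<le> (\<Sum>l\<in>C. 2)"
        unfolding i using F(1)
          by (intro sum_mono card_start_cover[OF I]) (auto simp: C_def cls_def i)
      finally have card: "card (A j) \<le> 2 * card C" by simp
      have "(\<Sum>v\<in>A j. price j v) \<le> (\<Sum>v\<in>A j. 2 * (u * 8 ^ j))" by (intro sum_mono price_le)
      also have "\<dots> = 2 * (u * 8 ^ j) * card (A j)" by simp
      also have "\<dots> \<le> 2 * (u * 8 ^ j) * (2 * card C)"
        using u card by (intro mult_left_mono) auto
      also have "\<dots> = (\<Sum>l\<in>C. 32 * (u * 8 ^ (j - 1)))" by (simp add: i)
      also have "\<dots> \<le> (\<Sum>l\<in>C. 32 * cost I l)"
        by (intro sum_mono) (auto simp: C_def cls_def)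
      also have "\<dots> = (\<Sum>l\<in>F. if cls j l then 32 * cost I l else 0)"
        unfolding C_def using finF by (simp add: sum.inter_filter)
      finally show ?thesis using \<open>j \<noteq> 1\<close> by simp
    qed
  qed
  have cls_unique: False if "cls i l" "cls j l" "i < j" for i j l
  proof -
    have "u * 8 ^ i \<le> u * 8 ^ (j - 1)" using that u by (intro mult_left_mono power_increasing) auto
    then show False using that by (auto simp: cls_def)
  qed
  \<comment> \<open>The classes are disjoint, so every link pays at one level only.\<close>
  have once: "(\<Sum>j\<le>K. if cls j l then 32 * cost I l else 0) \<le> 32 * cost I l" if "l \<in> F" for l
  proof (cases "\<exists>j. cls j l")
    case True
    then obtain i where i: "cls i l" ..
    have "cls j l \<longleftrightarrow> j = i" for j using i cls_unique linorder_neqE_nat by metis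
    then show ?thesis using cost0[OF that] by (simp add: sum.delta)
  qed (use cost0[OF that] in simp)
  have "(\<Sum>j\<le>K. \<Sum>v\<in>A j. price j v) \<le>
      (\<Sum>j\<le>K. (if j = 1 then 16 * u * card X else 0) + (\<Sum>l\<in>F. if cls j l then 32 * cost I l else 0))"
    by (intro sum_mono level_le)
  also have "\<dots> = 16 * u * card X + (\<Sum>j\<le>K. \<Sum>l\<in>F. if cls j l then 32 * cost I l else 0)"
    using K by (simp add: sum.distrib sum.delta)
  also have "(\<Sum>j\<le>K. \<Sum>l\<in>F. if cls j l then 32 * cost I l else 0)
      = (\<Sum>l\<in>F. \<Sum>j\<le>K. if cls j l then 32 * cost I l else 0)" by (rule sum.swap)
  also have "\<dots> \<le> (\<Sum>l\<in>F. 32 * cost I l)" by (intro sum_mono once)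
  also have "\<dots> = 32 * opt I X" unfolding F(3)[symmetric] total_cost_def
    by (rule sum_distrib_left[symmetric])
  also have "16 * u * card X \<le> 16 * (G / 4 ^ K)"
  proof -
    have "16 * u * card X \<le> 16 * u * 2 ^ K"
      using u X(3) by (intro mult_left_mono) (auto simp flip: of_nat_le_iff)
    also have "(8::real) ^ K = 4 ^ K * 2 ^ K" by (simp flip: power_mult_distrib)
    then have "16 * u * 2 ^ K = 16 * (G / 4 ^ K)" by (simp add: u_def)
    finally show ?thesis .
  qed
  finally have S: "(\<Sum>j\<le>K. \<Sum>v\<in>A j. price j v) \<le> 32 * opt I X + 16 * (G / 4 ^ K)" by simp
  have "(1 + 1 / real K) ^ K \<le> exp 1"
    using K by (intro exp_ge_one_plus_x_over_n_power_n) auto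
  then have e3: "(1 + 1 / real K) ^ K \<le> 3" using exp_le by linarith
  have "total_charge K X \<le> (1 + 1 / real K) ^ K * (cap * (\<Sum>j\<le>K. \<Sum>v\<in>A j. price j v))"
    by (intro total_charge_le finX finA cov)
  also have "\<dots> \<le> 3 * (cap * (32 * opt I X + 16 * (G / 4 ^ K)))"
    using e3 S cap by (intro mult_mono) (auto intro!: sum_nonneg mult_nonneg_nonneg price_nonneg)
  finally show ?thesis by (simp add: u_def)
qed

section \<open>Threshold rules and switching between strategies\<close>

text \<open>\<open>R\<close> is the rent of the whole sequence and \<open>w\<close> the price; with
  threshold \<open>t\<close> one rents until the rent reaches \<open>t * w\<close> and then buys.
  \<open>T\<close> measures the loss against buying, and \<open>K\<close> the number of levels over
  which the loss against renting stays bounded.\<close>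

definition rental_rule :: "nat pmf \<Rightarrow> nat \<Rightarrow> nat \<Rightarrow> bool" where
  "rental_rule q T K \<longleftrightarrow> finite (set_pmf q) \<and> (\<forall>R w. 0 \<le> R \<longrightarrow> 0 \<le> w \<longrightarrow>
     measure_pmf.expectation q (\<lambda>t. min R (real t * w) + (if real t * w \<le> R then w else 0))
       \<le> min ((1 + 1 / real K) * R) ((1 + real T) * w))"

text \<open>One buys only if \<open>R\<close> is at least \<open>T * w\<close>, so the price is at
  most \<open>R / T\<close>.\<close>

lemma rental_rule_return:
  assumes "1 \<le> T"
  shows "rental_rule (return_pmf T) T T"
proof -
  have "min R (real T * w) + (if real T * w \<le> R then w else 0)
      \<le> min ((1 + 1 / real T) * R) ((1 + real T) * w)" if "0 \<le> R" "0 \<le> w" for R w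
  proof (cases "real T * w \<le> R")
    case True
    then have "w \<le> R / real T" using assms by (simp add: field_simps)
    then show ?thesis using True by (simp add: algebra_simps)
  next
    case False
    then show ?thesis using that by (simp add: algebra_simps)
  qed
  then show ?thesis by (simp add: rental_rule_def)
qed

definition doubling_pmf :: "nat \<Rightarrow> nat pmf" where
  "doubling_pmf T = embed_pmf (\<lambda>t. if t \<in> {1..T} then 2 ^ (t - 1) / (2 ^ T - 1) else 0)"

lemma sum_doubling: "(\<Sum>t=1..T. 2 ^ (t - 1)) = (2 ^ T - 1 :: real)"
  by (induction T) auto

lemma pmf_doubling:
  assumes "1 \<le> T"
  shows "pmf (doubling_pmf T) t = (if t \<in> {1..T} then 2 ^ (t - 1) / (2 ^ T - 1) else 0)"
proof -
  have pos: "(2::real) ^ T - 1 > 0" using assms by simp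
  define f :: "nat \<Rightarrow> real" where "f t = (if t \<in> {1..T} then 2 ^ (t - 1) / (2 ^ T - 1) else 0)" for t
  have f0: "0 \<le> f t" for t using pos by (simp add: f_def)
  have "(\<integral>\<^sup>+x. ennreal (f x) \<partial>count_space UNIV) = (\<Sum>x\<in>{1..T}. ennreal (f x))"
    by (rule nn_integral_count_space') (auto simp: f_def)
  also have "\<dots> = ennreal (\<Sum>x=1..T. f x)" by (rule sum_ennreal) (rule f0)
  also have "(\<Sum>x=1..T. f x) = (\<Sum>x=1..T. 2 ^ (x - 1)) / (2 ^ T - 1)"
    by (simp add: f_def sum_divide_distrib)
  also have "\<dots> = 1" using pos sum_doubling[of T] by simp
  finally show ?thesis
    using pmf_embed_pmf[of f t] f0 by (simp add: doubling_pmf_def f_def[abs_def])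
qed

text \<open>With weights \<open>2 ^ (t - 1)\<close>, the thresholds up to \<open>n\<close> have
  weighted cost at most \<open>2 ^ n * R\<close>: if \<open>R\<close> reaches \<open>n * w\<close>,
  threshold \<open>t\<close> costs \<open>(t + 1) * w\<close> and the sum is
  \<open>n * 2 ^ n * w\<close>; otherwise threshold \<open>n\<close> costs only \<open>R\<close> and
  the rest follows by induction. Division by the total weight \<open>2 ^ T - 1\<close> yields the
  factor \<open>1 + 1 / (2 ^ T - 1)\<close>.\<close>

lemma rental_rule_doubling:
  assumes "1 \<le> T"
  shows "rental_rule (doubling_pmf T) T (2 ^ T - 1)"
proof -
  have set: "set_pmf (doubling_pmf T) \<subseteq> {1..T}"
    using assms by (auto simp: set_pmf_eq pmf_doubling split: if_splits)
  have pos: "(2::real) ^ T - 1 > 0" using assms by simp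
  have K: "real (2 ^ T - 1) = 2 ^ T - 1" by (simp add: of_nat_diff)
  have "measure_pmf.expectation (doubling_pmf T) (\<lambda>t. min R (real t * w) + (if real t * w \<le> R then w else 0))
      \<le> min ((1 + 1 / real (2 ^ T - 1)) * R) ((1 + real T) * w)" if R: "0 \<le> R" and w: "0 \<le> w" for R w
  proof -
    define h where "h t = min R (real t * w) + (if real t * w \<le> R then w else 0)" for t
    have "measure_pmf.expectation (doubling_pmf T) h = (\<Sum>t=1..T. pmf (doubling_pmf T) t *\<^sub>R h t)"
      using set by (intro integral_measure_pmf) auto
    also have "\<dots> = (\<Sum>t=1..T. 2 ^ (t - 1) * h t) / (2 ^ T - 1)"
      using assms by (simp add: pmf_doubling sum_divide_distrib)
    finally have E: "measure_pmf.expectation (doubling_pmf T) h = (\<Sum>t=1..T. 2 ^ (t - 1) * h t) / (2 ^ T - 1)" .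
    have closed: "(\<Sum>t=1..n. 2 ^ (t - 1) * ((real t + 1) * w)) = real n * 2 ^ n * w" for n
      by (induction n) (auto simp: algebra_simps)
    have rent: "(\<Sum>t=1..n. 2 ^ (t - 1) * h t) \<le> 2 ^ n * R" for n
    proof (induction n)
      case 0
      then show ?case using R by simp
    next
      case (Suc n)
      show ?case
      proof (cases "real (Suc n) * w \<le> R")
        case True
        have "h t = (real t + 1) * w" if "t \<le> Suc n" for t
        proof -
          have "real t * w \<le> real (Suc n) * w" using that w by (intro mult_right_mono) auto
          then show ?thesis using True by (simp add: h_def algebra_simps)
        qed
        then have "(\<Sum>t=1..Suc n. 2 ^ (t - 1) * h t) = real (Suc n) * 2 ^ Suc n * w"
          unfolding closed[symmetric] by (intro sum.cong) auto
        also have "\<dots> \<le> 2 ^ Suc n * R"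
          using mult_left_mono[OF True, of "2 ^ Suc n"] by (simp add: algebra_simps)
        finally show ?thesis .
      next
        case False
        then have "h (Suc n) = R" by (simp add: h_def)
        then show ?thesis using Suc by (simp add: algebra_simps)
      qed
    qed
    have cap: "(\<Sum>t=1..T. 2 ^ (t - 1) * h t) \<le> (2 ^ T - 1) * ((1 + real T) * w)"
    proof -
      have "h t \<le> (1 + real T) * w" if "t \<le> T" for t
      proof -
        have "h t \<le> (1 + real t) * w" using w by (simp add: h_def algebra_simps)
        also have "\<dots> \<le> (1 + real T) * w" using that w by (intro mult_right_mono) auto
        finally show ?thesis .
      qed
      then have "(\<Sum>t=1..T. 2 ^ (t - 1) * h t) \<le> (\<Sum>t=1..T. 2 ^ (t - 1) * ((1 + real T) * w))"
        by (intro sum_mono mult_left_mono) auto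
      then show ?thesis by (simp only: sum_distrib_right[symmetric] sum_doubling)
    qed
    have "(1 + 1 / real (2 ^ T - 1)) * R = 2 ^ T * R / (2 ^ T - 1)"
      unfolding K using pos by (simp add: field_simps)
    moreover have "(\<Sum>t=1..T. 2 ^ (t - 1) * h t) / (2 ^ T - 1) \<le> 2 ^ T * R / (2 ^ T - 1)"
      using rent[of T] pos by (intro divide_right_mono) auto
    moreover have "(\<Sum>t=1..T. 2 ^ (t - 1) * h t) / (2 ^ T - 1) \<le> (1 + real T) * w"
      using cap pos by (simp only: divide_le_eq) (simp add: mult.commute)
    ultimately show ?thesis unfolding h_def[symmetric] using E by simp
  qed
  then show ?thesis using set by (auto simp: rental_rule_def intro: finite_subset)
qed

section \<open>Switching between strategies\<close>

lemma purchased_take: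
  "t \<le> length xs \<Longrightarrow> purchased S (take t xs) = (\<Union>i<t. S (take (Suc i) xs))"
  by (auto simp: purchased_def min_def)

lemma purchased_subset: "(\<And>ys. S ys \<subseteq> L) \<Longrightarrow> purchased S xs \<subseteq> L"
  by (auto simp: purchased_def)

text \<open>\<open>\<phi>\<close> tells which strategy is active. What is bought while
  \<open>m\<close> is active is among what \<open>R m\<close> alone would have bought up to the last
  time \<open>t m\<close> at which \<open>m\<close> is active. These times do not depend on
  \<open>R\<close>, so they can be fixed before an expectation over random strategies is
  taken.\<close>

lemma purchased_switch:
  assumes "\<forall>i<length xs. \<phi> (take (Suc i) xs) \<le> (M :: nat)"
  shows "\<exists>t. (\<forall>m. t m \<le> length xs \<and> (t m = 0 \<or> \<phi> (take (t m) xs) = m)) \<and>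
    (\<forall>R. purchased (\<lambda>ys. R (\<phi> ys) ys) xs \<subseteq> (\<Union>m\<le>M. purchased (R m) (take (t m) xs)))"
proof -
  \<comment> \<open>The inserted \<open>0\<close> yields the empty prefix for an \<open>m\<close>
    that is never active.\<close>
  define N where "N m = insert 0 {i. i \<le> length xs \<and> \<phi> (take i xs) = m}" for m
  define t where "t m = Max (N m)" for m
  have fin: "finite (N m)" for m by (simp add: N_def)
  have "t m \<in> N m" for m unfolding t_def using fin by (intro Max_in) (auto simp: N_def)
  note t_mem = this[unfolded N_def]
  have t: "t m \<le> length xs \<and> (t m = 0 \<or> \<phi> (take (t m) xs) = m)" for m
    using t_mem[of m] by auto
  have "purchased (\<lambda>ys. R (\<phi> ys) ys) xs \<subseteq> (\<Union>m\<le>M. purchased (R m) (take (t m) xs))" for R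
  proof
    fix l assume "l \<in> purchased (\<lambda>ys. R (\<phi> ys) ys) xs"
    then obtain i where i: "i < length xs" "l \<in> R (\<phi> (take (Suc i) xs)) (take (Suc i) xs)"
      by (auto simp: purchased_def)
    let ?m = "\<phi> (take (Suc i) xs)"
    have "Suc i \<le> t ?m" unfolding t_def using fin i by (intro Max_ge) (auto simp: N_def)
    then have "l \<in> purchased (R ?m) (take (t ?m) xs)"
      using i t[of ?m] by (subst purchased_take) auto
    then show "l \<in> (\<Union>m\<le>M. purchased (R m) (take (t m) xs))" using assms i by blast
  qed
  with t show ?thesis by blast
qed

lemma expected_switch_cost:
  fixes R :: "'r \<Rightarrow> nat \<Rightarrow> nat list \<Rightarrow> 'a set"
  assumes I: "I \<in> wpap_instances" and p: "finite (set_pmf p)"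
    and sub: "\<And>r m ys. R r m ys \<subseteq> links I"
    and phases: "\<forall>i<length xs. \<phi> (take (Suc i) xs) \<le> (M :: nat)"
    and cost: "\<And>m t. m \<le> M \<Longrightarrow> t \<le> length xs \<Longrightarrow> \<phi> (take t xs) = m \<Longrightarrow>
      measure_pmf.expectation p (\<lambda>r. total_cost I (purchased (R r m) (take t xs))) \<le> b m"
    and nonneg: "\<And>m. 0 \<le> b m"
  shows "measure_pmf.expectation p (\<lambda>r. total_cost I (purchased (\<lambda>ys. R r (\<phi> ys) ys) xs)) \<le> (\<Sum>m\<le>M. b m)"
proof -
  from purchased_switch[of xs \<phi> M, OF phases] obtain t
    where t': "\<forall>m. t m \<le> length xs \<and> (t m = 0 \<or> \<phi> (take (t m) xs) = m)"
      and cov: "\<forall>R :: nat \<Rightarrow> nat list \<Rightarrow> 'a set. purchased (\<lambda>ys. R (\<phi> ys) ys) xs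
        \<subseteq> (\<Union>m\<le>M. purchased (R m) (take (t m) xs))"
    by (elim exE conjE) (rule that)
  have t: "t m \<le> length xs" "t m = 0 \<or> \<phi> (take (t m) xs) = m" for m using t' by auto
  have finl: "finite F" if "F \<subseteq> links I" for F using that finite_links[OF I] finite_subset by blast
  have pl: "purchased (R r m) ys \<subseteq> links I" for r m ys by (intro purchased_subset sub)
  have "total_cost I (purchased (\<lambda>ys. R r (\<phi> ys) ys) xs)
      \<le> (\<Sum>m\<le>M. total_cost I (purchased (R r m) (take (t m) xs)))" for r
  proof -
    have "total_cost I (purchased (\<lambda>ys. R r (\<phi> ys) ys) xs)
        \<le> total_cost I (\<Union>m\<le>M. purchased (R r m) (take (t m) xs))"
      using spec[OF cov, of "R r"] pl by (intro total_cost_mono[OF I]) blast+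
    also have "\<dots> \<le> (\<Sum>m\<le>M. total_cost I (purchased (R r m) (take (t m) xs)))"
      unfolding total_cost_def using pl finl cost_nonneg[OF I]
      by (intro sum_UN_le) blast+
    finally show ?thesis .
  qed
  then have "measure_pmf.expectation p (\<lambda>r. total_cost I (purchased (\<lambda>ys. R r (\<phi> ys) ys) xs))
      \<le> measure_pmf.expectation p (\<lambda>r. \<Sum>m\<le>M. total_cost I (purchased (R r m) (take (t m) xs)))"
    by (intro expectation_mono_finite p)
  also have "\<dots> = (\<Sum>m\<le>M. measure_pmf.expectation p (\<lambda>r. total_cost I (purchased (R r m) (take (t m) xs))))"
    by (rule expectation_sum_finite[OF p])
  also have "\<dots> \<le> (\<Sum>m\<le>M. b m)"
  proof (rule sum_mono)
    fix m assume "m \<in> {..M}"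
    then show "measure_pmf.expectation p (\<lambda>r. total_cost I (purchased (R r m) (take (t m) xs))) \<le> b m"
      using t(2)[of m] cost[of m "t m"] t(1)[of m] nonneg[of m]
      by (cases "t m = 0") (auto simp: purchased_def total_cost_def)
  qed
  finally show ?thesis .
qed

section \<open>Stages for the number of requests\<close>

text \<open>Stage \<open>i\<close> is meant for up to \<open>2 ^ K i\<close> requests. The
  thresholds double from stage to stage, so the last stage dominates the sum. The offset
  \<open>3\<close> makes \<open>K i\<close> at least \<open>i + 8\<close>, which keeps the additive
  errors of all stages within \<open>3 / 8\<close> of the budget.\<close>

locale rental_schedule =
  fixes K :: "nat \<Rightarrow> nat" and q :: "nat \<Rightarrow> nat pmf"
  assumes K_ge: "2 ^ (i + 3) \<le> K i"
    and rule: "rental_rule (q i) (2 ^ (i + 3)) (K i)"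
begin

definition stage :: "nat \<Rightarrow> nat" where
  "stage n = (LEAST i. n \<le> 2 ^ K i)"

definition stage_charge :: "'l wpap \<Rightarrow> real \<Rightarrow> nat \<Rightarrow> nat set \<Rightarrow> real" where
  "stage_charge I G i X =
     rental_hierarchy.total_charge (start I (G / 8 ^ K i)) (segment_cover I (G / 8 ^ K i)) (cost I)
       (1 + 1 / real (K i)) (1 + real (2 ^ (i + 3))) (K i) X"

definition stage_response :: "'l wpap \<Rightarrow> real \<Rightarrow> (nat \<Rightarrow> nat) \<Rightarrow> nat \<Rightarrow> 'l strategy" where
  "stage_response I G \<tau> i =
     rental_hierarchy.respond (start I (G / 8 ^ K i)) (segment_cover I (G / 8 ^ K i)) (cost I)
       (1 + 1 / real (K i)) (1 + real (2 ^ (i + 3))) \<tau> (K i)"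

text \<open>The number of requests is not known in advance, so the stage follows the number seen so
  far. A stage takes all of \<open>ys\<close> into account, including requests that arrived before
  it became active.\<close>

definition rental_response :: "'l wpap \<Rightarrow> real \<Rightarrow> (nat \<Rightarrow> nat \<Rightarrow> nat) \<Rightarrow> 'l strategy" where
  "rental_response I G r ys = stage_response I G (r (stage (length ys))) (stage (length ys)) ys"

text \<open>Stage \<open>i\<close> is active during the first \<open>2 ^ K i\<close> requests at
  most, so its charge needs to count only those.\<close>

definition rental_charge :: "'l wpap \<Rightarrow> real \<Rightarrow> nat list \<Rightarrow> real" where
  "rental_charge I G xs = (\<Sum>i\<le>stage (length xs). stage_charge I G i (set (take (2 ^ K i) xs)))"

text \<open>Independent thresholds for all levels of all stages up to \<open>n\<close>, drawn
  beforehand; by \<open>stage_le_self\<close> these stages suffice for \<open>n\<close>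
  requests.\<close>

definition thresholds :: "nat \<Rightarrow> (nat \<Rightarrow> nat \<Rightarrow> nat) pmf" where
  "thresholds n = Pi_pmf {..n} (\<lambda>_. 0) (\<lambda>i. Pi_pmf {1..K i} 0 (\<lambda>_. q i))"

lemma K_ge_add: "i + 8 \<le> K i"
proof -
  have "i + 8 \<le> 2 ^ (i + 3)"
  proof (induction i)
    case (Suc i)
    have "(2::nat) ^ (Suc i + 3) = 2 * 2 ^ (i + 3)" by (simp only: add_Suc power_Suc)
    with Suc show ?case by linarith
  qed simp
  then show ?thesis using K_ge[of i] by simp
qed

lemma ex_stage: "n \<le> 2 ^ K n"
proof -
  have "n \<le> K n" using K_ge_add[of n] by simp
  also have "\<dots> \<le> 2 ^ K n" by (rule less_imp_le[OF less_exp])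
  finally show ?thesis .
qed

lemma le_stage: "n \<le> 2 ^ K (stage n)"
  unfolding stage_def using ex_stage by (rule LeastI)

lemma stage_le: "n \<le> 2 ^ K i \<Longrightarrow> stage n \<le> i"
  unfolding stage_def by (rule Least_le)

lemma stage_le_self: "stage n \<le> n"
  by (rule stage_le[OF ex_stage])

lemma stage_mono: "m \<le> n \<Longrightarrow> stage m \<le> stage n"
  using le_stage[of n] by (intro stage_le) simp

lemma hierarchy:
  assumes "I \<in> wpap_instances"
  shows "rental_hierarchy (start I u) (segment_cover I u) (cost I) (1 + 1 / real (K i)) (1 + real (2 ^ (i + 3)))"
  using assms by (intro rental_hierarchy_segments) auto

lemma stage_charge_mono:
  assumes "I \<in> wpap_instances" "finite Y" "X \<subseteq> Y"
  shows "stage_charge I G i X \<le> stage_charge I G i Y"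
  unfolding stage_charge_def
  by (rule rental_hierarchy.total_charge_mono[OF hierarchy[OF assms(1)] assms(2,3)])

lemma stage_charge_empty: "I \<in> wpap_instances \<Longrightarrow> stage_charge I G i {} = 0"
  unfolding stage_charge_def rental_hierarchy.total_charge_def[OF hierarchy] by simp

lemma stage_charge_nonneg:
  "I \<in> wpap_instances \<Longrightarrow> finite X \<Longrightarrow> 0 \<le> stage_charge I G i X"
  using stage_charge_mono[of I X "{}"] by (simp add: stage_charge_empty)

lemma stage_response_eq:
  assumes "I \<in> wpap_instances"
  obtains j where "stage_response I G \<tau> i ys
    = segment_cover I (G / 8 ^ K i) j (start I (G / 8 ^ K i) j (last ys))"
  unfolding stage_response_def rental_hierarchy.respond_def[OF hierarchy[OF assms]] Let_def by blast

lemma segment_cover_links: "I \<in> wpap_instances \<Longrightarrow> segment_cover I u j s \<subseteq> links I"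
  unfolding segment_cover_def by (intro best_cover segment_coverable)

lemma stage_response_links:
  assumes "I \<in> wpap_instances" shows "stage_response I G \<tau> i ys \<subseteq> links I"
  using stage_response_eq[OF assms, of G \<tau> i ys] segment_cover_links[OF assms] by metis

lemma rental_response_links: "I \<in> wpap_instances \<Longrightarrow> rental_response I G r ys \<subseteq> links I"
  unfolding rental_response_def by (rule stage_response_links)

lemma rental_response_covers:
  assumes I: "I \<in> wpap_instances" and e: "last ys \<in> covered I (links I)"
  shows "last ys \<in> covered I (rental_response I G r ys)"
proof -
  define i where "i = stage (length ys)"
  obtain j where j: "stage_response I G (r i) i ys
      = segment_cover I (G / 8 ^ K i) j (start I (G / 8 ^ K i) j (last ys))"
    using stage_response_eq[OF I] .
  have "last ys \<in> segment I (G / 8 ^ K i) j (start I (G / 8 ^ K i) j (last ys))"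
    using e by (simp add: segment_def)
  then show ?thesis
    using best_cover(2)[OF I segment_coverable, of "G / 8 ^ K i" j "start I (G / 8 ^ K i) j (last ys)"]
    unfolding rental_response_def i_def[symmetric] j segment_cover_def by blast
qed

lemma finite_thresholds: "finite (set_pmf (thresholds n))"
  unfolding thresholds_def using rule by (intro finite_set_Pi_pmf) (auto simp: rental_rule_def)

lemma expected_stage_cost:
  assumes I: "I \<in> wpap_instances" and i: "i \<le> n"
  shows "measure_pmf.expectation (thresholds n) (\<lambda>r. total_cost I (purchased (stage_response I G (r i) i) xs))
    \<le> stage_charge I G i (set xs)"
proof -
  let ?P = "Pi_pmf {1..K i} 0 (\<lambda>_. q i)"
  interpret rental_hierarchy "start I (G / 8 ^ K i)" "segment_cover I (G / 8 ^ K i)" "cost I"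
    "1 + 1 / real (K i)" "1 + real (2 ^ (i + 3))"
    by (rule hierarchy[OF I])
  have "map_pmf (\<lambda>r. r i) (thresholds n) = ?P"
    unfolding thresholds_def using i by (subst Pi_pmf_component) auto
  then have "measure_pmf.expectation (thresholds n) (\<lambda>r. total_cost I (purchased (stage_response I G (r i) i) xs))
      = measure_pmf.expectation ?P (\<lambda>\<tau>. total_cost I (purchased (stage_response I G \<tau> i) xs))"
    using integral_map_pmf[of "\<lambda>r. r i" "thresholds n"
        "\<lambda>\<tau>. total_cost I (purchased (stage_response I G \<tau> i) xs)"] by simp
  also have "\<dots> \<le> stage_charge I G i (set xs)"
    unfolding stage_charge_def stage_response_def total_cost_def
    using rule[of i] by (intro expected_purchased_le_total_charge) (auto simp: rental_rule_def)
  finally show ?thesis .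
qed

lemma expected_rental_cost:
  assumes I: "I \<in> wpap_instances" and n: "length xs \<le> n"
  shows "measure_pmf.expectation (thresholds n) (\<lambda>r. total_cost I (purchased (rental_response I G r) xs))
    \<le> rental_charge I G xs"
proof -
  have "measure_pmf.expectation (thresholds n) (\<lambda>r. total_cost I (purchased
      (\<lambda>ys. stage_response I G (r (stage (length ys))) (stage (length ys)) ys) xs))
    \<le> (\<Sum>i\<le>stage (length xs). stage_charge I G i (set (take (2 ^ K i) xs)))"
  proof (rule expected_switch_cost[OF I finite_thresholds, where
      R = "\<lambda>r i. stage_response I G (r i) i" and \<phi> = "\<lambda>ys. stage (length ys)"])
    fix m t assume m: "m \<le> stage (length xs)" and t: "t \<le> length xs" "stage (length (take t xs)) = m"
    have "t \<le> 2 ^ K m" using le_stage[of "length (take t xs)"] t by simp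
    then have "set (take t xs) \<subseteq> set (take (2 ^ K m) xs)" by (rule set_take_subset_set_take)
    moreover have "m \<le> n" using m n stage_le_self[of "length xs"] by simp
    ultimately show "measure_pmf.expectation (thresholds n)
        (\<lambda>r. total_cost I (purchased (stage_response I G (r m) m) (take t xs)))
      \<le> stage_charge I G m (set (take (2 ^ K m) xs))"
      using expected_stage_cost[OF I, of m n G "take t xs"] stage_charge_mono[OF I]
        by (meson finite_set order_trans)
  qed (auto intro: stage_mono stage_charge_nonneg I stage_response_links[OF I, THEN subsetD])
  then show ?thesis by (simp add: rental_response_def[abs_def] rental_charge_def)
qed

lemma rental_charge_take:
  assumes "I \<in> wpap_instances"
  shows "rental_charge I G (take t xs) \<le> rental_charge I G xs"
proof -
  have sub: "set (take (2 ^ K i) (take t xs)) \<subseteq> set (take (2 ^ K i) xs)" for i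
    using set_take_subset_set_take[of "min (2 ^ K i) t" "2 ^ K i" xs] by simp
  have "rental_charge I G (take t xs)
      \<le> (\<Sum>i\<le>stage (length (take t xs)). stage_charge I G i (set (take (2 ^ K i) xs)))"
    unfolding rental_charge_def
    by (intro sum_mono stage_charge_mono assms sub finite_set)
  also have "\<dots> \<le> rental_charge I G xs"
    unfolding rental_charge_def using stage_mono[of "length (take t xs)" "length xs"]
    by (intro sum_mono2) (auto intro: stage_charge_nonneg assms)
  finally show ?thesis .
qed

lemma rental_charge_nonneg: "I \<in> wpap_instances \<Longrightarrow> 0 \<le> rental_charge I G xs"
  unfolding rental_charge_def by (intro sum_nonneg stage_charge_nonneg) auto

lemma rental_charge_Nil: "I \<in> wpap_instances \<Longrightarrow> rental_charge I G [] = 0"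
  by (simp add: rental_charge_def stage_charge_empty)

text \<open>Summing \<open>total_charge_bound\<close> over the stages gives two geometric series:
  the multiples of the optimum roughly double, so the last stage dominates, and the additive errors
  halve, adding up to at most \<open>3 / 8 * G\<close>.\<close>

lemma rental_charge_le:
  assumes I: "I \<in> wpap_instances" and G: "0 < G"
    and xs: "set xs \<subseteq> covered I (links I)" "opt I (set xs) \<le> G"
  shows "rental_charge I G xs \<le> 384 * 2 ^ (stage (length xs) + 3) * opt I (set xs) + 3 / 8 * G"
proof -
  let ?O = "opt I (set xs)" and ?s = "stage (length xs)"
  have O: "0 \<le> ?O" by (rule opt_nonneg[OF I xs(1)])
  have each: "stage_charge I G i (set (take (2 ^ K i) xs))
      \<le> 96 * (1 + 2 ^ (i + 3)) * ?O + 48 / 2 ^ (i + 8) * G" for i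
  proof -
    let ?X = "set (take (2 ^ K i) xs)"
    have X: "?X \<subseteq> set xs" by (rule set_take_subset)
    have o: "opt I ?X \<le> ?O" by (rule opt_mono[OF I X xs(1)])
    have "stage_charge I G i ?X \<le> 3 * (1 + real (2 ^ (i + 3))) * (32 * opt I ?X + 16 * (G / 4 ^ K i))"
      unfolding stage_charge_def
    proof (rule total_charge_bound[OF I G])
      show "1 \<le> K i" using K_ge_add[of i] by simp
      show "card ?X \<le> 2 ^ K i" by (rule order_trans[OF card_length]) simp
    qed (use X xs o in auto)
    also have "\<dots> \<le> 3 * (1 + real (2 ^ (i + 3))) * (32 * ?O + 16 * (G / 4 ^ K i))"
      using o by (intro mult_left_mono) auto
    also have "\<dots> = 96 * (1 + 2 ^ (i + 3)) * ?O + 48 * G * ((1 + 2 ^ (i + 3)) / 4 ^ K i)"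
      by (simp add: algebra_simps add_divide_distrib)
    \<comment> \<open>One factor \<open>2 ^ K i\<close> absorbs the cap, the other is at least
      \<open>2 ^ (i + 8)\<close>.\<close>
    also have "(1 + 2 ^ (i + 3)) / 4 ^ K i \<le> (1 / 2 ^ (i + 8) :: real)"
    proof -
      have "1 + K i \<le> 2 ^ K i" by (metis Suc_leI less_exp plus_1_eq_Suc)
      then have "real (1 + K i) \<le> real (2 ^ K i)" by (simp only: of_nat_le_iff)
      then have "1 + real (K i) \<le> 2 ^ K i" by simp
      moreover have "2 ^ (i + 3) \<le> real (K i)"
        by (metis K_ge of_nat_le_iff of_nat_numeral of_nat_power)
      ultimately have 1: "1 + 2 ^ (i + 3) \<le> (2 ^ K i :: real)" by linarith
      have 2: "(2::real) ^ (i + 8) \<le> 2 ^ K i" using K_ge_add by (intro power_increasing) auto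
      have "(1 + 2 ^ (i + 3)) * 2 ^ (i + 8) \<le> (2 ^ K i * 2 ^ K i :: real)"
        using 1 2 by (intro mult_mono) auto
      also have "\<dots> = 4 ^ K i" by (simp flip: power_mult_distrib)
      finally show ?thesis by (simp add: divide_simps mult.commute)
    qed
    then have "48 * G * ((1 + 2 ^ (i + 3)) / 4 ^ K i) \<le> 48 * G * (1 / 2 ^ (i + 8))"
      using G by (intro mult_left_mono) auto
    finally show ?thesis by (simp add: algebra_simps)
  qed
  have sum1: "(\<Sum>i\<le>s. 96 * (1 + 2 ^ (i + 3)) * x) \<le> 384 * 2 ^ (s + 3) * x" if "0 \<le> x" for s and x :: real
  proof -
    have "(\<Sum>i\<le>s. 1 + 2 ^ (i + 3)) \<le> (4 * 2 ^ (s + 3) - 8 :: real)"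
    proof (induction s)
      case (Suc s)
      have "(2::real) ^ (Suc s + 3) = 2 * 2 ^ (s + 3)" by (simp only: add_Suc power_Suc)
      moreover have "(1::real) \<le> 2 ^ (s + 3)" by (rule one_le_power) simp
      ultimately show ?case using Suc by (simp only: sum.atMost_Suc)
    qed simp
    from mult_right_mono[OF this, of "96 * x"] that
    have "(\<Sum>i\<le>s. 1 + 2 ^ (i + 3)) * (96 * x) \<le> 384 * 2 ^ (s + 3) * x" by (simp add: algebra_simps)
    then show ?thesis by (simp add: sum_distrib_left sum_distrib_right algebra_simps)
  qed
  have sum2: "(\<Sum>i\<le>s. 48 / 2 ^ (i + 8) * G) \<le> 3 / 8 * G" for s
  proof -
    have "(\<Sum>i\<le>s. 48 / 2 ^ (i + 8)) = (3 / 8 - 48 / 2 ^ (s + 8) :: real)"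
    proof (induction s)
      case (Suc s)
      have "(2::real) ^ (Suc s + 8) = 2 * 2 ^ (s + 8)" by (simp only: add_Suc power_Suc)
      then show ?case using Suc by simp
    qed simp
    then have "(\<Sum>i\<le>s. 48 / 2 ^ (i + 8)) \<le> (3 / 8 :: real)" by simp
    from mult_right_mono[OF this, of G] G show ?thesis by (simp add: sum_distrib_right)
  qed
  have "rental_charge I G xs \<le> (\<Sum>i\<le>?s. 96 * (1 + 2 ^ (i + 3)) * ?O + 48 / 2 ^ (i + 8) * G)"
    unfolding rental_charge_def by (intro sum_mono each)
  also have "\<dots> = (\<Sum>i\<le>?s. 96 * (1 + 2 ^ (i + 3)) * ?O) + (\<Sum>i\<le>?s. 48 / 2 ^ (i + 8) * G)"
    by (rule sum.distrib)
  finally show ?thesis using sum1[OF O, of ?s] sum2[of ?s] by linarith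
qed

section \<open>Phases for the budget\<close>

text \<open>Strictly below every positive cost, so that the budget of phase \<open>0\<close> pays
  for free links only.\<close>

definition unit_price :: "'l wpap \<Rightarrow> real" where
  "unit_price I = (SOME d. 0 < d \<and> (\<forall>l\<in>links I. 0 < cost I l \<longrightarrow> d < cost I l))"

definition budget :: "'l wpap \<Rightarrow> nat \<Rightarrow> real" where
  "budget I m = unit_price I * 2 ^ m"

text \<open>Free links are demanded so that requests they cover never become residual; this makes an
  optimum of \<open>0\<close> cost nothing.\<close>

definition affordable :: "'l wpap \<Rightarrow> nat \<Rightarrow> 'l set \<Rightarrow> bool" where
  "affordable I m F \<longleftrightarrow> F \<subseteq> links I \<and> {l \<in> links I. cost I l = 0} \<subseteq> F \<and> total_cost I F \<le> budget I m"

definition prepaid :: "'l wpap \<Rightarrow> nat set \<Rightarrow> nat \<Rightarrow> 'l set" where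
  "prepaid I Xhat m = arg_min (\<lambda>F. card (Xhat - covered I F)) (affordable I m)"

definition residual :: "'l wpap \<Rightarrow> nat set \<Rightarrow> nat \<Rightarrow> nat list \<Rightarrow> nat list" where
  "residual I Xhat m xs = filter (\<lambda>e. e \<notin> covered I (prepaid I Xhat m)) xs"

text \<open>The charge stands in for the expected cost. It is determined by the requests seen so
  far, so the phase is the same for all random choices.\<close>

definition phase :: "'l wpap \<Rightarrow> nat set \<Rightarrow> nat list \<Rightarrow> nat" where
  "phase I Xhat xs = (LEAST m. rental_charge I (budget I m) (residual I Xhat m xs) \<le> budget I m)"

text \<open>Naming the prepaid links at every request costs nothing extra, because purchases form a
  set. The rental part is consulted only if the last request is residual; otherwise the residual
  sequence does not end with it.\<close>

definition phase_response ::
    "'l wpap \<Rightarrow> nat set \<Rightarrow> (nat \<Rightarrow> nat \<Rightarrow> nat) \<Rightarrow> nat \<Rightarrow> 'l strategy" where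
  "phase_response I Xhat r m xs = prepaid I Xhat m \<union>
     (if last xs \<in> covered I (prepaid I Xhat m) then {}
      else rental_response I (budget I m) r (residual I Xhat m xs))"

definition predicted_strategy :: "'l wpap \<Rightarrow> nat set \<Rightarrow> (nat \<Rightarrow> nat \<Rightarrow> nat) \<Rightarrow> 'l strategy" where
  "predicted_strategy I Xhat r xs = phase_response I Xhat r (phase I Xhat xs) xs"

lemma unit_price:
  assumes "I \<in> wpap_instances"
  shows "0 < unit_price I" "l \<in> links I \<Longrightarrow> 0 < cost I l \<Longrightarrow> unit_price I < cost I l"
proof -
  let ?C = "insert 1 (cost I ` {l \<in> links I. 0 < cost I l})"
  have fin: "finite ?C" using finite_links[OF assms] by simp
  then have "0 < Min ?C" by (subst Min_gr_iff) auto
  moreover have "Min ?C \<le> cost I l" if "l \<in> links I" "0 < cost I l" for l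
    using fin that by (intro Min_le) auto
  ultimately have "0 < Min ?C / 2 \<and> (\<forall>l\<in>links I. 0 < cost I l \<longrightarrow> Min ?C / 2 < cost I l)"
    by fastforce
  then have "0 < unit_price I \<and> (\<forall>l\<in>links I. 0 < cost I l \<longrightarrow> unit_price I < cost I l)"
    unfolding unit_price_def by (rule someI)
  then show "0 < unit_price I" "l \<in> links I \<Longrightarrow> 0 < cost I l \<Longrightarrow> unit_price I < cost I l" by auto
qed

lemma budget_pos: "I \<in> wpap_instances \<Longrightarrow> 0 < budget I m"
  by (simp add: budget_def unit_price)

lemma affordable_free_links:
  assumes "I \<in> wpap_instances" shows "affordable I m {l \<in> links I. cost I l = 0}"
  using budget_pos[OF assms, of m] by (auto simp: affordable_def total_cost_def)

lemma affordable_Un_free_links: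
  assumes I: "I \<in> wpap_instances" and F: "F \<subseteq> links I" "total_cost I F \<le> budget I m"
  shows "affordable I m (F \<union> {l \<in> links I. cost I l = 0})"
  using total_cost_Un[OF I F(1), of "{l \<in> links I. cost I l = 0}"] F
  by (auto simp: affordable_def total_cost_def[of I "{l \<in> links I. cost I l = 0}"])

lemma prepaid:
  assumes "I \<in> wpap_instances"
  shows "affordable I m (prepaid I Xhat m)"
    "affordable I m F \<Longrightarrow> card (Xhat - covered I (prepaid I Xhat m)) \<le> card (Xhat - covered I F)"
proof -
  note free = affordable_free_links[OF assms, of m]
  show "affordable I m (prepaid I Xhat m)"
    unfolding prepaid_def by (rule arg_min_natI[of "affordable I m", OF free])
  show "affordable I m F \<Longrightarrow> card (Xhat - covered I (prepaid I Xhat m)) \<le> card (Xhat - covered I F)"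
    unfolding prepaid_def by (rule arg_min_nat_le[of "affordable I m"])
qed

lemma prepaid_links: "I \<in> wpap_instances \<Longrightarrow> prepaid I Xhat m \<subseteq> links I"
  using prepaid(1)[of I m Xhat] by (auto simp: affordable_def)

lemma prepaid_cost: "I \<in> wpap_instances \<Longrightarrow> total_cost I (prepaid I Xhat m) \<le> budget I m"
  using prepaid(1)[of I m Xhat] by (auto simp: affordable_def)

lemma prepaid_cost_nonneg: "I \<in> wpap_instances \<Longrightarrow> 0 \<le> total_cost I (prepaid I Xhat m)"
  by (intro total_cost_nonneg prepaid_links)

lemma phase_response_links: "I \<in> wpap_instances \<Longrightarrow> phase_response I Xhat r m ys \<subseteq> links I"
  unfolding phase_response_def using prepaid_links[of I Xhat m] rental_response_links[of I]
  by (auto split: if_splits)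

lemma set_residual: "set (residual I Xhat m xs) \<subseteq> set xs"
  by (auto simp: residual_def)

lemma residual_take:
  "residual I Xhat m (take t xs)
    = take (length (residual I Xhat m (take t xs))) (residual I Xhat m xs)"
proof -
  have "residual I Xhat m xs = residual I Xhat m (take t xs) @ residual I Xhat m (drop t xs)"
    unfolding residual_def by (simp flip: filter_append)
  then show ?thesis by simp
qed

lemma rental_charge_residual_take:
  "I \<in> wpap_instances \<Longrightarrow> rental_charge I G (residual I Xhat m (take t xs)) \<le> rental_charge I G (residual I Xhat m xs)"
  by (subst residual_take) (rule rental_charge_take)

text \<open>The charge exceeds \<open>3 / 8\<close> of the budget by at most \<open>B\<close>, which
  does not depend on \<open>m\<close>, so a large budget suffices.\<close>

lemma ex_phase:
  assumes I: "I \<in> wpap_instances" and xs: "set xs \<subseteq> covered I (links I)"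
  shows "\<exists>m. rental_charge I (budget I m) (residual I Xhat m xs) \<le> budget I m"
proof -
  define L where "L = total_cost I (links I)"
  define B where "B = 384 * 2 ^ (stage (length xs) + 3) * L"
  have L: "0 \<le> L" unfolding L_def by (intro total_cost_nonneg I) simp
  have B: "0 \<le> B" using L by (simp add: B_def)
  obtain m where "2 * (L + B) / unit_price I < 2 ^ m" using real_arch_pow[of 2] by auto
  then have m: "2 * (L + B) \<le> budget I m"
    using unit_price(1)[OF I] by (simp add: budget_def field_simps)
  let ?Y = "residual I Xhat m xs"
  have Y: "set ?Y \<subseteq> covered I (links I)" using xs set_residual by blast
  have o: "opt I (set ?Y) \<le> L" unfolding L_def by (rule opt_le[OF I order_refl Y])
  have s: "stage (length ?Y) \<le> stage (length xs)" by (intro stage_mono) (simp add: residual_def)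
  have "rental_charge I (budget I m) ?Y \<le> 384 * 2 ^ (stage (length ?Y) + 3) * opt I (set ?Y) + 3 / 8 * budget I m"
    using o m L B by (intro rental_charge_le I Y budget_pos) auto
  also have "384 * 2 ^ (stage (length ?Y) + 3) * opt I (set ?Y) \<le> B"
    unfolding B_def using o s opt_nonneg[OF I Y] by (intro mult_mono power_increasing) auto
  finally have "rental_charge I (budget I m) ?Y \<le> B + 3 / 8 * budget I m" by simp
  moreover have "B \<le> budget I m / 2" using m L by simp
  ultimately have "rental_charge I (budget I m) ?Y \<le> budget I m" using B by linarith
  then show ?thesis ..
qed

text \<open>Charges grow with the sequence, so a budget that suffices for \<open>xs\<close> suffices
  for its prefixes.\<close>

lemma phase_mono:
  assumes "I \<in> wpap_instances" "set xs \<subseteq> covered I (links I)"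
  shows "phase I Xhat (take t xs) \<le> phase I Xhat xs"
  unfolding phase_def
proof (rule Least_le)
  let ?m = "LEAST m. rental_charge I (budget I m) (residual I Xhat m xs) \<le> budget I m"
  show "rental_charge I (budget I ?m) (residual I Xhat ?m (take t xs)) \<le> budget I ?m"
    using LeastI_ex[OF ex_phase[OF assms, of Xhat]] rental_charge_residual_take[OF assms(1)] order_trans
    by blast
qed

lemma serves_predicted_strategy:
  assumes I: "I \<in> wpap_instances" and xs: "set xs \<subseteq> covered I (links I)"
  shows "serves I (predicted_strategy I Xhat r) xs"
  unfolding serves_def
proof (intro allI impI conjI)
  fix i assume i: "i < length xs"
  define ys where "ys = take (Suc i) xs"
  have last: "last ys = xs ! i" using i by (simp add: ys_def take_Suc_conv_app_nth)
  have e: "xs ! i \<in> covered I (links I)" using xs i by (auto dest: nth_mem)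
  show "predicted_strategy I Xhat r (take (Suc i) xs) \<subseteq> links I"
    unfolding predicted_strategy_def by (rule phase_response_links[OF I])
  have "xs ! i \<in> covered I (predicted_strategy I Xhat r ys)"
  proof (cases "last ys \<in> covered I (prepaid I Xhat (phase I Xhat ys))")
    case True
    then show ?thesis by (auto simp: predicted_strategy_def phase_response_def covered_def last)
  next
    case False
    have "last (residual I Xhat (phase I Xhat ys) ys) = last ys"
      using False i by (simp add: residual_def ys_def take_Suc_conv_app_nth)
    then show ?thesis
      using rental_response_covers[OF I, of "residual I Xhat (phase I Xhat ys) ys"] e False last
      by (auto simp: predicted_strategy_def phase_response_def covered_def)
  qed
  moreover have "predicted_strategy I Xhat r ys \<subseteq> purchased (predicted_strategy I Xhat r) ys"
    using UN_upper[of i "{..<length ys}" "\<lambda>i. predicted_strategy I Xhat r (take (Suc i) ys)"] i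
    by (simp add: purchased_def ys_def)
  ultimately show "xs ! i \<in> covered I (purchased (predicted_strategy I Xhat r) (take (Suc i) xs))"
    by (auto simp: covered_def ys_def)
qed

text \<open>The rental part sees exactly the residual requests in their order, hence each of its
  responses is given on a prefix of the residual sequence.\<close>

lemma purchased_phase_response:
  "purchased (phase_response I Xhat r m) xs \<subseteq>
     prepaid I Xhat m \<union> purchased (rental_response I (budget I m) r) (residual I Xhat m xs)"
proof
  fix l assume "l \<in> purchased (phase_response I Xhat r m) xs"
  then obtain i where i: "i < length xs" "l \<in> phase_response I Xhat r m (take (Suc i) xs)"
    by (auto simp: purchased_def)
  have last: "last (take (Suc i) xs) = xs ! i" using i by (simp add: take_Suc_conv_app_nth)
  show "l \<in> prepaid I Xhat m \<union> purchased (rental_response I (budget I m) r) (residual I Xhat m xs)"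
  proof (cases "l \<in> prepaid I Xhat m")
    case False
    let ?Y = "residual I Xhat m (take (Suc i) xs)"
    from False i last have new: "xs ! i \<notin> covered I (prepaid I Xhat m)"
      and l: "l \<in> rental_response I (budget I m) r ?Y"
      by (auto simp: phase_response_def split: if_splits)
    define j where "j = length ?Y - 1"
    have "?Y \<noteq> []" using new i by (simp add: residual_def take_Suc_conv_app_nth)
    then have j: "length ?Y = Suc j" by (simp add: j_def)
    then have Y: "?Y = take (Suc j) (residual I Xhat m xs)"
      using residual_take[of I Xhat m "Suc i" xs] by simp
    then have "j < length (residual I Xhat m xs)" using j by simp
    then have "rental_response I (budget I m) r ?Y
        \<subseteq> purchased (rental_response I (budget I m) r) (residual I Xhat m xs)"
      unfolding Y purchased_def by (intro UN_upper) simp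
    then show ?thesis using l by blast
  qed simp
qed

lemma expected_phase_cost:
  assumes I: "I \<in> wpap_instances" and n: "length xs \<le> n"
  shows "measure_pmf.expectation (thresholds n) (\<lambda>r. total_cost I (purchased (phase_response I Xhat r m) xs))
    \<le> total_cost I (prepaid I Xhat m) + rental_charge I (budget I m) (residual I Xhat m xs)"
proof -
  let ?Y = "residual I Xhat m xs" and ?P = "prepaid I Xhat m"
  have links: "purchased (rental_response I (budget I m) r) ?Y \<subseteq> links I" for r
    by (intro purchased_subset rental_response_links I)
  have "total_cost I (purchased (phase_response I Xhat r m) xs)
      \<le> total_cost I ?P + total_cost I (purchased (rental_response I (budget I m) r) ?Y)" for r
    by (rule order_trans[OF total_cost_mono[OF I purchased_phase_response] total_cost_Un[OF I]])
      (simp_all add: links prepaid_links[OF I])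
  then have "measure_pmf.expectation (thresholds n) (\<lambda>r. total_cost I (purchased (phase_response I Xhat r m) xs))
      \<le> measure_pmf.expectation (thresholds n)
          (\<lambda>r. total_cost I ?P + total_cost I (purchased (rental_response I (budget I m) r) ?Y))"
    by (intro expectation_mono_finite finite_thresholds)
  also have "\<dots> = total_cost I ?P + measure_pmf.expectation (thresholds n)
          (\<lambda>r. total_cost I (purchased (rental_response I (budget I m) r) ?Y))"
    using integrable_measure_pmf_finite[OF finite_thresholds]
    by (subst Bochner_Integration.integral_add) simp_all
  also have "measure_pmf.expectation (thresholds n)
          (\<lambda>r. total_cost I (purchased (rental_response I (budget I m) r) ?Y)) \<le> rental_charge I (budget I m) ?Y"
    using n
      by (intro expected_rental_cost I) (auto simp: residual_def intro: order_trans[OF length_filter_le])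
  finally show ?thesis by simp
qed

text \<open>A phase is active only while its charge is within its budget, which accounts for the
  minimum.\<close>

lemma expected_predicted_cost:
  assumes I: "I \<in> wpap_instances" and n: "length xs \<le> n" and xs: "set xs \<subseteq> covered I (links I)"
  shows "measure_pmf.expectation (thresholds n) (\<lambda>r. total_cost I (purchased (predicted_strategy I Xhat r) xs))
    \<le> (\<Sum>m\<le>phase I Xhat xs. total_cost I (prepaid I Xhat m) +
          min (budget I m) (rental_charge I (budget I m) (residual I Xhat m xs)))"
proof -
  have "measure_pmf.expectation (thresholds n) (\<lambda>r. total_cost I
       (purchased (\<lambda>ys. phase_response I Xhat r (phase I Xhat ys) ys) xs))
    \<le> (\<Sum>m\<le>phase I Xhat xs. total_cost I (prepaid I Xhat m) +
          min (budget I m) (rental_charge I (budget I m) (residual I Xhat m xs)))"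
  proof (rule expected_switch_cost[OF I finite_thresholds, where
      R = "phase_response I Xhat" and \<phi> = "phase I Xhat"])
    show "\<forall>i<length xs. phase I Xhat (take (Suc i) xs) \<le> phase I Xhat xs"
      using phase_mono[OF I xs] by blast
  next
    fix m t assume t: "t \<le> length xs" "phase I Xhat (take t xs) = m"
    have "set (take t xs) \<subseteq> covered I (links I)" by (rule order_trans[OF set_take_subset xs])
    then have "rental_charge I (budget I m) (residual I Xhat m (take t xs)) \<le> budget I m"
      using LeastI_ex[OF ex_phase[OF I]] t(2) unfolding phase_def by blast
    then show "measure_pmf.expectation (thresholds n)
        (\<lambda>r. total_cost I (purchased (phase_response I Xhat r m) (take t xs)))
      \<le> total_cost I (prepaid I Xhat m) +
          min (budget I m) (rental_charge I (budget I m) (residual I Xhat m xs))"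
      using expected_phase_cost[OF I, of "take t xs" n Xhat m] n t(1)
        rental_charge_residual_take[OF I, of "budget I m" Xhat m t xs] by simp
  next
    show "0 \<le> total_cost I (prepaid I Xhat m) +
        min (budget I m) (rental_charge I (budget I m) (residual I Xhat m xs))" for m
      using prepaid_cost_nonneg[OF I] budget_pos[OF I] rental_charge_nonneg[OF I]
      by (intro add_nonneg_nonneg) (auto intro: less_imp_le)
  qed (rule phase_response_links[OF I])
  then show ?thesis by (simp only: predicted_strategy_def[abs_def])
qed

text \<open>The links bought at the start of a phase whose budget suffices for \<open>X\<close> leave at most
  as many predicted elements uncovered as an optimal solution for \<open>X\<close> does, and those that the
  latter leaves uncovered are no-shows.\<close>

lemma length_residual_le_pred_error:
  assumes I: "I \<in> wpap_instances" and Xhat: "finite Xhat" and xs: "distinct xs"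
    "set xs \<subseteq> covered I (links I)" and opt: "opt I (set xs) \<le> budget I m"
  shows "length (residual I Xhat m xs) \<le> pred_error (set xs) Xhat"
proof -
  let ?X = "set xs" and ?C = "covered I (prepaid I Xhat m)"
  \<comment> \<open>Adding the free links makes the optimal cover affordable without raising its
    cost.\<close>
  let ?F = "best_cover I ?X \<union> {l \<in> links I. cost I l = 0}"
  note F = best_cover[OF I xs(2)]
  have "affordable I m ?F" by (rule affordable_Un_free_links[OF I F(1)]) (simp add: F(3) opt)
  then have "card (Xhat - ?C) \<le> card (Xhat - covered I ?F)" by (rule prepaid(2)[OF I])
  also have "\<dots> \<le> card (Xhat - ?X)"
    using F(2) Xhat by (intro card_mono) (auto simp: covered_def)
  finally have noshow: "card (Xhat - ?C) \<le> card (Xhat - ?X)" .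
  have len: "length (residual I Xhat m xs) = card (?X - ?C)"
    using xs(1) by (simp add: residual_def distinct_length_filter Int_def set_diff_eq conj_commute)
  have "card (?X - ?C) \<le> card ((?X - Xhat) \<union> (Xhat - ?C))"
    using Xhat by (intro card_mono) auto
  also have "\<dots> \<le> card (?X - Xhat) + card (Xhat - ?C)" by (rule card_Un_le)
  also have "\<dots> \<le> card (?X - Xhat) + card (Xhat - ?X)" using noshow by simp
  also have "\<dots> = card ((?X - Xhat) \<union> (Xhat - ?X))"
    using Xhat by (intro card_Un_disjoint[symmetric]) auto
  finally have "card (?X - ?C) \<le> card ((?X - Xhat) \<union> (Xhat - ?X))" .
  moreover have "card (?X - ?C) \<le> card ?X" by (intro card_mono) auto
  ultimately show ?thesis by (simp add: pred_error_def len)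
qed

text \<open>\<open>5000\<close> exceeds \<open>8 * 8 * 384 / 5\<close>, the constant arising in
  \<open>expected_cost_le_ratio\<close>.\<close>

definition ratio :: "nat \<Rightarrow> real" where
  "ratio \<eta> = 5000 * 2 ^ (stage \<eta> + 3)"

text \<open>Budgets double, so all phases together cost at most 4 times the last budget, which is 8
  times that of the phase \<open>m\<close> before. If that budget is below the optimum, the bound is
  immediate. Otherwise phase \<open>m\<close> failed although at most \<open>\<eta>\<close> requests
  were residual, so \<open>rental_charge_le\<close> bounds its budget by a multiple of the
  optimum.\<close>

lemma expected_cost_le_ratio:
  assumes I: "I \<in> wpap_instances" and Xhat: "finite Xhat" and n: "length xs \<le> n"
    and xs: "distinct xs" "set xs \<subseteq> covered I (links I)"
  shows "measure_pmf.expectation (thresholds n) (\<lambda>r. total_cost I (purchased (predicted_strategy I Xhat r) xs))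
    \<le> ratio (pred_error (set xs) Xhat) * opt I (set xs)"
proof -
  let ?O = "opt I (set xs)" and ?M = "phase I Xhat xs" and ?\<rho> = "ratio (pred_error (set xs) Xhat)"
  define b where "b m = total_cost I (prepaid I Xhat m) +
      min (budget I m) (rental_charge I (budget I m) (residual I Xhat m xs))" for m
  have E: "measure_pmf.expectation (thresholds n) (\<lambda>r. total_cost I (purchased (predicted_strategy I Xhat r) xs))
      \<le> (\<Sum>m\<le>?M. b m)"
    using expected_predicted_cost[OF I n xs(2), of Xhat] by (simp only: b_def)
  note F = best_cover[OF I xs(2)]
  have O: "0 \<le> ?O" by (rule opt_nonneg[OF I xs(2)])
  have b_le: "b m \<le> 2 * budget I m" for m using prepaid_cost[OF I, of Xhat m] by (simp add: b_def)
  have b_sum: "(\<Sum>m\<le>n. b m) \<le> 4 * budget I n" for n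
  proof -
    have "(\<Sum>m\<le>n. b m) \<le> (\<Sum>m\<le>n. 2 * budget I m)" by (intro sum_mono b_le)
    also have "\<dots> = 4 * budget I n - 2 * unit_price I"
      by (induction n) (auto simp: budget_def)
    finally show ?thesis using unit_price(1)[OF I] by simp
  qed
  have ratio8: "8 \<le> ?\<rho>"
  proof -
    have "(1::real) \<le> 2 ^ (stage (pred_error (set xs) Xhat) + 3)" by (rule one_le_power) simp
    then show ?thesis unfolding ratio_def by linarith
  qed
  show ?thesis
  proof (cases "?O = 0")
    case True
    \<comment> \<open>For optimum \<open>0\<close> the free links serve all requests, and phase
      \<open>0\<close>, which buys nothing else, is never left.\<close>
    have "l \<in> prepaid I Xhat 0" if "l \<in> best_cover I (set xs)" for l
    proof -
      have "cost I l \<le> 0" using cost_le_total_cost[OF I F(1) that] F(3) True by simp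
      moreover have "0 \<le> cost I l" using cost_nonneg[OF I] F(1) that by blast
      ultimately show ?thesis using prepaid(1)[OF I, of 0 Xhat] F(1) that
        by (auto simp: affordable_def)
    qed
    then have "residual I Xhat 0 xs = []"
      using F(2) by (force simp: residual_def covered_def filter_empty_conv)
    then have Z: "rental_charge I (budget I 0) (residual I Xhat 0 xs) = 0"
      by (simp add: rental_charge_Nil I)
    then have M: "?M = 0"
      unfolding phase_def using budget_pos[OF I, of 0] by (intro Least_eq_0) simp
    have "cost I l = 0" if "l \<in> prepaid I Xhat 0" for l
    proof (rule ccontr)
      assume "cost I l \<noteq> 0"
      then have "unit_price I < cost I l"
        using unit_price(2)[OF I] cost_nonneg[OF I, of l] prepaid_links[OF I] that by fastforce
      then show False
        using cost_le_total_cost[OF I prepaid_links[OF I] that] prepaid_cost[OF I, of Xhat 0]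
        by (simp add: budget_def)
    qed
    then have "total_cost I (prepaid I Xhat 0) = 0" by (simp add: total_cost_def)
    then have "b 0 = 0" using Z budget_pos[OF I, of 0] by (simp add: b_def)
    then show ?thesis using E M True by simp
  next
    case False
    \<comment> \<open>An optimal cover now contains a link of positive cost, which exceeds the
      budget of phase \<open>0\<close>.\<close>
    have "\<exists>l\<in>best_cover I (set xs). cost I l \<noteq> 0"
      using False F(3) by (auto simp: total_cost_def intro: ccontr)
    then obtain l where l: "l \<in> best_cover I (set xs)" "cost I l \<noteq> 0" ..
    have "unit_price I < cost I l"
      using unit_price(2)[OF I] cost_nonneg[OF I, of l] F(1) l by fastforce
    then have unit: "unit_price I \<le> ?O" using cost_le_total_cost[OF I F(1) l(1)] F(3) by simp
    have "(\<Sum>m\<le>?M. b m) \<le> ?\<rho> * ?O"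
    proof (cases ?M)
      case 0
      have "(\<Sum>m\<le>?M. b m) \<le> 4 * ?O" using b_sum[of 0] unit 0 by (simp add: budget_def)
      also have "\<dots> \<le> ?\<rho> * ?O" using ratio8 O by (intro mult_right_mono) auto
      finally show ?thesis .
    next
      case (Suc m)
      have sum: "(\<Sum>m\<le>?M. b m) \<le> 8 * budget I m" using b_sum[of ?M] Suc by (simp add: budget_def)
      show ?thesis
      proof (cases "?O \<le> budget I m")
        case True
        let ?Y = "residual I Xhat m xs"
        have Y: "set ?Y \<subseteq> covered I (links I)" using xs(2) set_residual by blast
        have o: "opt I (set ?Y) \<le> ?O" by (rule opt_mono[OF I set_residual xs(2)])
        have s: "stage (length ?Y) \<le> stage (pred_error (set xs) Xhat)"
          by (intro stage_mono length_residual_le_pred_error I Xhat xs True)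
        \<comment> \<open>\<open>m\<close> lies before the least phase that succeeds.\<close>
        have "budget I m < rental_charge I (budget I m) ?Y"
          using not_less_Least[of m "\<lambda>m. rental_charge I (budget I m) (residual I Xhat m xs) \<le> budget I m"] Suc
          by (simp add: phase_def)
        also have "\<dots> \<le> 384 * 2 ^ (stage (length ?Y) + 3) * opt I (set ?Y) + 3 / 8 * budget I m"
          using o True by (intro rental_charge_le I Y budget_pos) auto
        also have "384 * 2 ^ (stage (length ?Y) + 3) * opt I (set ?Y)
            \<le> 384 * 2 ^ (stage (pred_error (set xs) Xhat) + 3) * ?O"
          using o s opt_nonneg[OF I Y] by (intro mult_mono power_increasing) auto
        \<comment> \<open>The additive \<open>3 / 8\<close> of the budget moves to the left and
          leaves \<open>5 / 8\<close> there.\<close>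
        finally have "5 * budget I m \<le> 8 * (384 * 2 ^ (stage (pred_error (set xs) Xhat) + 3) * ?O)"
          by simp
        moreover have "0 \<le> 2 ^ (stage (pred_error (set xs) Xhat) + 3) * ?O" using O by simp
        ultimately show ?thesis using sum by (simp add: ratio_def)
      next
        case False
        then have "(\<Sum>m\<le>?M. b m) \<le> 8 * ?O" using sum by simp
        also have "\<dots> \<le> ?\<rho> * ?O" using ratio8 O by (intro mult_right_mono) auto
        finally show ?thesis .
      qed
    qed
    then show ?thesis using E by simp
  qed
qed

section \<open>Competitive ratios\<close>

lemma competitive_on_requests:
  assumes I: "I \<in> wpap_instances" and Xhat: "Xhat \<subseteq> elems I" and xs: "xs \<in> request_seqs I"
  shows "serves I (predicted_strategy I Xhat r) xs"
    "measure_pmf.expectation (thresholds (num_elems I))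
       (\<lambda>r. total_cost I (purchased (predicted_strategy I Xhat r) xs))
     \<le> ratio (pred_error (set xs) Xhat) * opt I (set xs)"
proof -
  have xs': "distinct xs" "set xs \<subseteq> elems I" "set xs \<subseteq> covered I (links I)"
    using xs by (auto simp: request_seqs_def)
  have fin: "finite (elems I)" by (simp add: elems_def)
  have "card (set xs) \<le> card (elems I)" using xs'(2) fin by (intro card_mono)
  then have n: "length xs \<le> num_elems I" using xs'(1) by (simp add: distinct_card elems_def)
  show "serves I (predicted_strategy I Xhat r) xs" by (rule serves_predicted_strategy[OF I xs'(3)])
  show "measure_pmf.expectation (thresholds (num_elems I))
       (\<lambda>r. total_cost I (purchased (predicted_strategy I Xhat r) xs))
     \<le> ratio (pred_error (set xs) Xhat) * opt I (set xs)"
    using expected_cost_le_ratio[OF I finite_subset[OF Xhat fin] n xs'(1,3)] .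
qed

lemma rand_competitive_predicted:
  assumes "\<I> \<subseteq> wpap_instances"
  shows "rand_competitive \<I> ratio
    (\<lambda>I Xhat. map_pmf (predicted_strategy I Xhat) (thresholds (num_elems I)))"
  unfolding rand_competitive_def
proof (intro ballI allI impI conjI)
  fix I Xhat xs assume I: "I \<in> \<I>" and *: "Xhat \<subseteq> elems I" "xs \<in> request_seqs I"
  from I assms have "I \<in> wpap_instances" by blast
  note competitive = competitive_on_requests[OF this *]
  show "serves I S xs"
    if "S \<in> set_pmf (map_pmf (predicted_strategy I Xhat) (thresholds (num_elems I)))" for S
    using that competitive(1) by auto
  show "measure_pmf.expectation (map_pmf (predicted_strategy I Xhat) (thresholds (num_elems I)))
      (\<lambda>S. total_cost I (purchased S xs)) \<le> ratio (pred_error (set xs) Xhat) * opt I (set xs)"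
    using competitive(2) by simp
qed

text \<open>When the thresholds are point masses, a single strategy remains, and its expected cost
  is its cost.\<close>

lemma det_competitive_predicted:
  assumes "\<I> \<subseteq> wpap_instances" and "\<And>n. thresholds n = return_pmf (r n)"
  shows "det_competitive \<I> ratio (\<lambda>I Xhat. predicted_strategy I Xhat (r (num_elems I)))"
  unfolding det_competitive_def
proof (intro ballI allI impI conjI)
  fix I Xhat xs assume I: "I \<in> \<I>" and *: "Xhat \<subseteq> elems I" "xs \<in> request_seqs I"
  from I assms(1) have "I \<in> wpap_instances" by blast
  from competitive_on_requests[OF this *]
  show "serves I (predicted_strategy I Xhat (r (num_elems I))) xs"
    "total_cost I (purchased (predicted_strategy I Xhat (r (num_elems I))) xs)
      \<le> ratio (pred_error (set xs) Xhat) * opt I (set xs)"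
    by (simp_all add: assms(2))
qed

lemma stage_Suc: "stage n = Suc i \<Longrightarrow> 2 ^ K i < n"
  using stage_le[of n i] by (cases "2 ^ K i < n") auto

text \<open>Reaching stage \<open>Suc i\<close> takes more than \<open>2 ^ K i\<close> requests, so
  comparing \<open>f\<close> with the power of stage \<open>i\<close> is enough, as the power only
  doubles from there. Stage \<open>0\<close> contributes the constant
  \<open>5000 * 8\<close>.\<close>

lemma ratio_bigo:
  fixes f :: "nat \<Rightarrow> real"
  assumes f: "eventually (\<lambda>n. 1 \<le> f n) sequentially"
    and stage: "\<And>i n. 2 ^ K i < n \<Longrightarrow> 2 ^ (i + 3) \<le> C * f n"
  shows "ratio \<in> O(f)"
proof (rule bigoI)
  show "\<forall>\<^sub>F n in sequentially. norm (ratio n) \<le> (40000 + 10000 * \<bar>C\<bar>) * norm (f n)"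
    using f
  proof eventually_elim
    case (elim n)
    show ?case
    proof (cases "stage n")
      case 0
      have "40000 * 1 \<le> (40000 + 10000 * \<bar>C\<bar>) * f n" using elim by (intro mult_mono) auto
      then show ?thesis using 0 elim by (simp add: ratio_def)
    next
      case (Suc i)
      have "ratio n = 10000 * 2 ^ (i + 3)" by (simp add: ratio_def Suc power_add)
      also have "\<dots> \<le> 10000 * (C * f n)" using stage[OF stage_Suc[OF Suc]] by simp
      also have "\<dots> \<le> 10000 * (\<bar>C\<bar> * f n)" using elim by (simp add: mult_right_mono)
      also have "\<dots> \<le> (40000 + 10000 * \<bar>C\<bar>) * f n" using elim by (simp add: algebra_simps)
      finally show ?thesis using elim by (simp add: ratio_def)
    qed
  qed
qed

end

text \<open>\<open>K i\<close> equals the threshold here, so stage \<open>i\<close> reaches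
  \<open>2 ^ 2 ^ (i + 3)\<close> requests and the ratio is logarithmic.\<close>

interpretation det: rental_schedule "\<lambda>i. 2 ^ (i + 3)" "\<lambda>i. return_pmf (2 ^ (i + 3))"
  by unfold_locales (auto intro: rental_rule_return)

text \<open>Random thresholds make \<open>K i\<close> exponential in the largest threshold, which
  puts one more exponential into the number of requests and one more logarithm into the
  ratio.\<close>

interpretation rand: rental_schedule "\<lambda>i. 2 ^ 2 ^ (i + 3) - 1" "\<lambda>i. doubling_pmf (2 ^ (i + 3))"
proof
  show "2 ^ (i + 3) \<le> 2 ^ 2 ^ (i + 3) - (1 :: nat)" for i
    using Suc_leI[OF less_exp[of "2 ^ (i + 3)"]] by linarith
  show "rental_rule (doubling_pmf (2 ^ (i + 3))) (2 ^ (i + 3)) (2 ^ 2 ^ (i + 3) - 1)" for i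
    by (rule rental_rule_doubling) simp
qed

lemma eventually_ln_ln_ge_1: "eventually (\<lambda>n. 1 \<le> ln (ln (real n))) sequentially"
  unfolding eventually_sequentially
proof (intro exI allI impI)
  fix n assume "nat \<lceil>exp (exp 1 :: real)\<rceil> \<le> n"
  then have "exp (exp 1) \<le> real n" by linarith
  then have "exp 1 \<le> ln (real n)" by (metis exp_gt_zero ln_exp ln_le_cancel_iff order_less_le_trans)
  then show "1 \<le> ln (ln (real n))"
    by (metis exp_gt_zero ln_exp ln_le_cancel_iff order_less_le_trans)
qed

lemma det_ratio_bigo: "det.ratio \<in> O(\<lambda>\<eta>. ln (real \<eta>))"
proof (rule det.ratio_bigo)
  show "eventually (\<lambda>n. 1 \<le> ln (real n)) sequentially"
    using eventually_ln_ln_ge_1 eventually_ge_at_top[of 1]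
  proof eventually_elim
    case (elim n)
    have "ln (real n) \<noteq> 0" using elim(1) by (metis ln_0 not_one_le_zero)
    then have "0 < ln (real n)" using elim(2) ln_ge_zero[of "real n"] by linarith
    then have "ln (ln (real n)) \<le> ln (real n) - 1" by (rule ln_le_minus_one)
    then show ?case using elim by linarith
  qed
next
  fix i n :: nat
  assume "2 ^ 2 ^ (i + 3) < n"
  then have "(2::real) ^ 2 ^ (i + 3) \<le> real n"
    by (metis less_imp_le of_nat_le_iff of_nat_numeral of_nat_power)
  then have "ln ((2::real) ^ 2 ^ (i + 3)) \<le> ln (real n)" by (intro ln_mono) auto
  then have "2 ^ (i + 3) * ln 2 \<le> ln (real n)" by (simp add: ln_realpow)
  then show "2 ^ (i + 3) \<le> (1 / ln 2) * ln (real n)" by (simp add: field_simps)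
qed

lemma rand_ratio_bigo: "rand.ratio \<in> O(\<lambda>\<eta>. ln (ln (real \<eta>)))"
proof (rule rand.ratio_bigo)
  show "eventually (\<lambda>n. 1 \<le> ln (ln (real n))) sequentially" by (rule eventually_ln_ln_ge_1)
next
  fix i n :: nat
  define T :: nat where "T = 2 ^ (i + 3)"
  have T: "8 \<le> T" by (simp add: T_def power_add)
  assume "2 ^ (2 ^ 2 ^ (i + 3) - 1) < n"
  then have "(2::real) ^ (2 ^ T - 1) \<le> real n"
    unfolding T_def by (metis less_imp_le of_nat_le_iff of_nat_numeral of_nat_power)
  then have "ln ((2::real) ^ (2 ^ T - 1)) \<le> ln (real n)" by (intro ln_mono) auto
  then have "(2 ^ T - 1) * ln 2 \<le> ln (real n)" by (simp add: ln_realpow of_nat_diff)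
  \<comment> \<open>This crude bound leaves \<open>ln (real n)\<close> at least
    \<open>2 ^ T / 4\<close>, so the second logarithm loses only the summand
    \<open>2 * ln 2\<close>.\<close>
  moreover have "(1 / 2 :: real) \<le> ln 2" using ln_le_minus_one[of "1 / 2 :: real"]
    by (simp add: ln_div)
  then have "(2 ^ T - 1) * (1 / 2) \<le> (2 ^ T - 1) * ln (2 :: real)" by (intro mult_left_mono) auto
  moreover have "(2::real) ^ 1 \<le> 2 ^ T" using T by (intro power_increasing) auto
  then have "2 ^ T / 4 \<le> (2 ^ T - 1) * (1 / 2 :: real)" by simp
  ultimately have "2 ^ T / 4 \<le> ln (real n)" by linarith
  then have "ln (2 ^ T / 4) \<le> ln (ln (real n))" by (intro ln_mono) auto
  moreover have "ln (2 ^ T / 4) = (real T - 2) * ln (2 :: real)"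
    using ln_realpow[of 2 2] by (simp add: ln_div ln_realpow algebra_simps)
  \<comment> \<open>As \<open>T\<close> is at least \<open>8\<close>, subtracting \<open>2\<close>
    loses less than half of it.\<close>
  moreover have "(real T / 2) * ln 2 \<le> (real T - 2) * ln 2" using T by (intro mult_right_mono) auto
  ultimately have "real T * ln 2 \<le> 2 * ln (ln (real n))" by linarith
  then have "real T \<le> (2 / ln 2) * ln (ln (real n))" by (simp add: field_simps)
  then show "2 ^ (i + 3) \<le> (2 / ln 2) * ln (ln (real n))" by (simp add: T_def)
qed

theorem theorem3p4:
  "(\<exists>(A :: nat det_alg) \<rho>. \<rho> \<in> O(\<lambda>\<eta>. ln (real \<eta>)) \<and>
      det_competitive wpap_instances \<rho> A) \<and>
   (\<exists>(A :: nat rand_alg) \<rho>. \<rho> \<in> O(\<lambda>\<eta>. ln (ln (real \<eta>))) \<and>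
      rand_competitive wpap_instances \<rho> A) \<and>
   (\<exists>A \<rho>. \<rho> \<in> O(\<lambda>\<eta>. ln (real \<eta>)) \<and>
      det_competitive parking_permit_instances \<rho> A) \<and>
   (\<exists>A \<rho>. \<rho> \<in> O(\<lambda>\<eta>. ln (ln (real \<eta>))) \<and>
      rand_competitive parking_permit_instances \<rho> A)"
proof -
  \<comment> \<open>A finite product of point masses is a point mass.\<close>
  have "\<exists>r. \<forall>n. det.thresholds n = return_pmf (r n)"
    unfolding det.thresholds_def by (auto intro!: choice simp: Pi_pmf_return_pmf)
  then obtain r where r: "\<And>n. det.thresholds n = return_pmf (r n)" by blast
  show ?thesis
    using det_ratio_bigo rand_ratio_bigo
      det.det_competitive_predicted[OF order_refl r] rand.rand_competitive_predicted[OF order_refl]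
      det.det_competitive_predicted[OF parking_permit_instances_subset r]
      rand.rand_competitive_predicted[OF parking_permit_instances_subset]
    by blast
qed

end
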